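(* Let $k \geq 2$ be an integer and let $$G = \langle a_1, \ldots, a_n \mid a_i^2 = 1,\ i = 1, \ldots, n;\ (a_i a_j)^{m_{ij}} = 1,\ 1 \leq i < j \leq n \rangle$$ be a Coxeter group (where $m_{ij}=\infty$ is allowed and means that there is no relation between $a_i$ and $a_j$) such that $m_{ij} \geq 3k+7$ for all $i < j$, and such that $G$ satisfies the Separability Condition. Then: 1. Every $k$-generated subgroup of $G$ which does not contain any conjugates of the generators $a_i$ is separable in $G$. 2. Every subgroup of $G$ generated by at most $(k+1)/2$ elements is separable in $G$.
   Context: A $k$-generated group is a group which can be generated by $k$ or fewer elements. Each $m_{ij}$ ($i<j$) is a positive integer or $\infty$, and $m_{ji}:=m_{ij}$. Separability Condition: $G$ is of extra-large type (that is, all $m_{ij}\ge 4$), all finite $m_{ij}$ in the presentation are even and, whenever three distinct generators $a_i, a_j, a_l$ are all pairwise related (that is, $m_{ij}<\infty$, $m_{il}<\infty$ and $m_{jl}<\infty$), then $m_{ij}$ is also divisible by $3$ (and thus divisible by $6$). (Since this is required for every such triple in every order, all three exponents $m_{ij}, m_{il}, m_{jl}$ are divisible by $6$.) A subgroup $H \leq G$ is separable in $G$ if for any $g \in G - H$ there exists a homomorphism $\psi : G \to K$ onto a finite group $K$ such that $\psi(g) \notin \psi(H)$; equivalently, $H$ is the intersection of all finite index subgroups of $G$ which contain $H$. *)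

theory Defs
  imports "HOL-Algebra.Generated_Groups" "HOL-Algebra.Elementary_Groups" "HOL-Library.Extended_Nat"
begin

section \<open>Groups given by generators and relators\<close>

text \<open>The letter \<open>(x, False)\<close> stands for the generator \<open>x\<close>, and \<open>(x, True)\<close> for its
  formal inverse.\<close>

type_synonym 'a word = "('a \<times> bool) list"

abbreviation words :: "'a set \<Rightarrow> 'a word set" where
  "words X \<equiv> lists (X \<times> UNIV)"

text \<open>The congruence on words over \<open>X\<close> generated by free cancellation and by the relators in
  \<open>R\<close> (meant to be a subset of \<open>words X\<close>). Its quotient is the quotient of the
  free group on \<open>X\<close> by the normal closure of \<open>R\<close>.\<close>

inductive_set word_rel :: "'a set \<Rightarrow> 'a word set \<Rightarrow> ('a word \<times> 'a word) set"
  for X :: "'a set" and R :: "'a word set" where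
  refl: "u \<in> words X \<Longrightarrow> (u, u) \<in> word_rel X R"
| sym: "(u, v) \<in> word_rel X R \<Longrightarrow> (v, u) \<in> word_rel X R"
| trans: "(u, v) \<in> word_rel X R \<Longrightarrow> (v, w) \<in> word_rel X R \<Longrightarrow> (u, w) \<in> word_rel X R"
| cancel: "u \<in> words X \<Longrightarrow> v \<in> words X \<Longrightarrow> x \<in> X \<Longrightarrow>
    (u @ [(x, b), (x, \<not> b)] @ v, u @ v) \<in> word_rel X R"
| relator: "u \<in> words X \<Longrightarrow> v \<in> words X \<Longrightarrow> r \<in> R \<Longrightarrow> (u @ r @ v, u @ v) \<in> word_rel X R"

definition presented_group :: "'a set \<Rightarrow> 'a word set \<Rightarrow> 'a word set monoid" where
  "presented_group X R =
    \<lparr>carrier = words X // word_rel X R,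
     mult = (\<lambda>A B. \<Union>u\<in>A. \<Union>v\<in>B. word_rel X R `` {u @ v}),
     one = word_rel X R `` {[]}\<rparr>"

definition presented_gen :: "'a set \<Rightarrow> 'a word set \<Rightarrow> 'a \<Rightarrow> 'a word set" where
  "presented_gen X R x = word_rel X R `` {[(x, False)]}"

lemma word_rel_words:
  assumes "R \<subseteq> words X" "(u, v) \<in> word_rel X R"
  shows "u \<in> words X \<and> v \<in> words X"
  using assms(2,1) by (induction rule: word_rel.induct) auto

lemma equiv_word_rel:
  assumes "R \<subseteq> words X"
  shows "equiv (words X) (word_rel X R)"
proof (rule equivI)
  show "word_rel X R \<subseteq> words X \<times> words X"
    using word_rel_words[OF assms] by (intro subrelI SigmaI) (simp_all only:)
  show "refl_on (words X) (word_rel X R)"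
    by (simp add: refl_on_def word_rel.refl)
  show "Relation.sym (word_rel X R)"
    by (meson symI word_rel.sym)
  show "Relation.trans (word_rel X R)"
    by (meson transI word_rel.trans)
qed

lemma word_rel_context:
  assumes R: "R \<subseteq> words X" and uv: "(u, v) \<in> word_rel X R" and p: "p \<in> words X" and q: "q \<in> words X"
  shows "(p @ u @ q, p @ v @ q) \<in> word_rel X R"
  using uv
proof (induction rule: word_rel.induct)
  case (refl u)
  then show ?case using p q by (auto intro!: word_rel.refl)
next
  case (sym u v)
  then show ?case by (blast intro: word_rel.sym)
next
  case (trans u v w)
  then show ?case by (blast intro: word_rel.trans)
next
  case (cancel u v x b)
  then show ?case
    using word_rel.cancel[of "p @ u" X "v @ q" x b R] p q by auto
next
  case (relator u v r)
  then show ?case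
    using word_rel.relator[of "p @ u" X "v @ q" r R] p q by auto
qed

lemma word_rel_append:
  assumes R: "R \<subseteq> words X" and "(u, u') \<in> word_rel X R" "(v, v') \<in> word_rel X R"
  shows "(u @ v, u' @ v') \<in> word_rel X R"
proof -
  note w = word_rel_words[OF R assms(2)] word_rel_words[OF R assms(3)]
  have "(u @ v, u' @ v) \<in> word_rel X R"
    using word_rel_context[OF R assms(2), of "[]" v] w by auto
  moreover have "(u' @ v, u' @ v') \<in> word_rel X R"
    using word_rel_context[OF R assms(3), of u' "[]"] w by auto
  ultimately show ?thesis by (rule word_rel.trans)
qed

lemma presented_group_mult:
  assumes R: "R \<subseteq> words X" and u: "u \<in> words X" and v: "v \<in> words X"
  shows "(word_rel X R `` {u}) \<otimes>\<^bsub>presented_group X R\<^esub> (word_rel X R `` {v}) = word_rel X R `` {u @ v}"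
proof -
  have *: "word_rel X R `` {u' @ v'} = word_rel X R `` {u @ v}"
    if "(u, u') \<in> word_rel X R" "(v, v') \<in> word_rel X R" for u' v'
    using word_rel_append[OF R that] equiv_class_eq[OF equiv_word_rel[OF R]] by metis
  have ne: "word_rel X R `` {u} \<noteq> {}" "word_rel X R `` {v} \<noteq> {}"
    using u v by (blast intro: word_rel.refl)+
  have "(\<Union>u'\<in>word_rel X R `` {u}. \<Union>v'\<in>word_rel X R `` {v}. word_rel X R `` {u' @ v'}) =
      (\<Union>u'\<in>word_rel X R `` {u}. \<Union>v'\<in>word_rel X R `` {v}. word_rel X R `` {u @ v})"
    using * by (intro SUP_cong) (simp_all only: Image_singleton_iff)
  also have "\<dots> = word_rel X R `` {u @ v}"
    using ne by (simp only: UN_constant if_False)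
  finally show ?thesis by (simp only: presented_group_def monoid.simps)
qed

lemma word_inverse:
  assumes R: "R \<subseteq> words X" and "u \<in> words X"
  shows "\<exists>v\<in>words X. (v @ u, []) \<in> word_rel X R"
  using assms(2)
proof (induction u)
  case Nil
  have "([] @ [], []) \<in> word_rel X R" using word_rel.refl[of "[]" X R] by simp
  then show ?case by blast
next
  case (Cons l u)
  obtain x b where l: "l = (x, b)" by (cases l)
  from Cons obtain v where v: "v \<in> words X" "(v @ u, []) \<in> word_rel X R" by auto
  have "(v @ [(x, \<not> b), (x, \<not> \<not> b)] @ u, v @ u) \<in> word_rel X R"
    using Cons v l by (intro word_rel.cancel) auto
  then have "((v @ [(x, \<not> b)]) @ l # u, []) \<in> word_rel X R"
    using v(2) word_rel.trans l by fastforce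
  moreover have "v @ [(x, \<not> b)] \<in> words X" using v Cons l by auto
  ultimately show ?case by blast
qed

lemma group_presented_group:
  assumes R: "R \<subseteq> words X"
  shows "group (presented_group X R)"
proof (rule groupI)
  let ?G = "presented_group X R"
  let ?c = "\<lambda>u. word_rel X R `` {u}"
  have carr: "carrier ?G = ?c ` words X" by (auto simp: presented_group_def quotient_def)
  have one: "\<one>\<^bsub>?G\<^esub> = ?c []" by (simp add: presented_group_def)
  note mult = presented_group_mult[OF R]
  show "x \<otimes>\<^bsub>?G\<^esub> y \<in> carrier ?G" if "x \<in> carrier ?G" "y \<in> carrier ?G" for x y
  proof -
    from that obtain u v where "u \<in> words X" "v \<in> words X" "x = ?c u" "y = ?c v"
      unfolding carr by blast
    then show ?thesis unfolding carr by (simp add: mult)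
  qed
  show "\<one>\<^bsub>?G\<^esub> \<in> carrier ?G" by (auto simp: carr one)
  show "(x \<otimes>\<^bsub>?G\<^esub> y) \<otimes>\<^bsub>?G\<^esub> z = x \<otimes>\<^bsub>?G\<^esub> (y \<otimes>\<^bsub>?G\<^esub> z)"
    if "x \<in> carrier ?G" "y \<in> carrier ?G" "z \<in> carrier ?G" for x y z
  proof -
    from that obtain u v w where "u \<in> words X" "v \<in> words X" "w \<in> words X"
      "x = ?c u" "y = ?c v" "z = ?c w" unfolding carr by blast
    then show ?thesis by (simp add: mult)
  qed
  show "\<one>\<^bsub>?G\<^esub> \<otimes>\<^bsub>?G\<^esub> x = x" if "x \<in> carrier ?G" for x
  proof -
    from that obtain u where "u \<in> words X" "x = ?c u" unfolding carr by blast
    then show ?thesis by (simp add: one mult)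
  qed
  show "\<exists>y\<in>carrier ?G. y \<otimes>\<^bsub>?G\<^esub> x = \<one>\<^bsub>?G\<^esub>" if "x \<in> carrier ?G" for x
  proof -
    from that obtain u where u: "u \<in> words X" "x = ?c u" unfolding carr by blast
    obtain v where v: "v \<in> words X" "(v @ u, []) \<in> word_rel X R"
      using word_inverse[OF R u(1)] by blast
    have "?c v \<otimes>\<^bsub>?G\<^esub> x = ?c (v @ u)" using u v by (simp add: mult)
    also have "\<dots> = \<one>\<^bsub>?G\<^esub>"
      using equiv_class_eq[OF equiv_word_rel[OF R] v(2)] by (simp add: one)
    finally show ?thesis using v(1) carr by blast
  qed
qed

section \<open>Coxeter groups\<close>

text \<open>Only the values of \<open>m\<close> at pairs of distinct indices in \<open>{1..n}\<close> matter; the diagonal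
  is unconstrained, since the relators \<open>a\<^sub>i\<^sup>2\<close> are imposed separately.\<close>

definition coxeter_exponents :: "nat \<Rightarrow> (nat \<Rightarrow> nat \<Rightarrow> enat) \<Rightarrow> bool" where
  "coxeter_exponents n m \<longleftrightarrow>
    (\<forall>i\<in>{1..n}. \<forall>j\<in>{1..n}. i \<noteq> j \<longrightarrow> m i j > 0 \<and> m i j = m j i)"

definition coxeter_relators :: "nat \<Rightarrow> (nat \<Rightarrow> nat \<Rightarrow> enat) \<Rightarrow> nat word set" where
  "coxeter_relators n m =
    {[(i, False), (i, False)] | i. i \<in> {1..n}} \<union>
    {concat (replicate p [(i, False), (j, False)]) | i j p.
       i \<in> {1..n} \<and> j \<in> {1..n} \<and> i < j \<and> m i j = enat p}"

definition coxeter_group :: "nat \<Rightarrow> (nat \<Rightarrow> nat \<Rightarrow> enat) \<Rightarrow> nat word set monoid" where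
  "coxeter_group n m = presented_group {1..n} (coxeter_relators n m)"

definition coxeter_gen :: "nat \<Rightarrow> (nat \<Rightarrow> nat \<Rightarrow> enat) \<Rightarrow> nat \<Rightarrow> nat word set" where
  "coxeter_gen n m i = presented_gen {1..n} (coxeter_relators n m) i"

lemma coxeter_relators_words: "coxeter_relators n m \<subseteq> words {1..n}"
proof -
  have "concat (replicate p [(i, False), (j, False)]) \<in> words {1..n}"
    if "i \<in> {1..n}" "j \<in> {1..n}" for i j p
    using that by (induction p) auto
  moreover have "[(i, False), (i, False)] \<in> words {1..n}" if "i \<in> {1..n}" for i
    using that by simp
  ultimately show ?thesis unfolding coxeter_relators_def by blast
qed

lemma group_coxeter_group: "group (coxeter_group n m)"
  unfolding coxeter_group_def by (rule group_presented_group[OF coxeter_relators_words])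

definition separability_condition :: "nat \<Rightarrow> (nat \<Rightarrow> nat \<Rightarrow> enat) \<Rightarrow> bool" where
  "separability_condition n m \<longleftrightarrow>
    (\<forall>i\<in>{1..n}. \<forall>j\<in>{1..n}. i \<noteq> j \<longrightarrow> 4 \<le> m i j) \<and>
    (\<forall>i\<in>{1..n}. \<forall>j\<in>{1..n}. \<forall>p. i \<noteq> j \<and> m i j = enat p \<longrightarrow> 2 dvd p) \<and>
    (\<forall>i\<in>{1..n}. \<forall>j\<in>{1..n}. \<forall>l\<in>{1..n}. \<forall>p.
       i \<noteq> j \<and> i \<noteq> l \<and> j \<noteq> l \<and> m i j = enat p \<and> m i l < \<infinity> \<and> m j l < \<infinity> \<longrightarrow> 3 dvd p)"

section \<open>Generation and separability\<close>

definition k_generated_subgroup :: "nat \<Rightarrow> ('a, 'b) monoid_scheme \<Rightarrow> 'a set \<Rightarrow> bool" where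
  "k_generated_subgroup k G H \<longleftrightarrow>
    (\<exists>S. S \<subseteq> carrier G \<and> finite S \<and> card S \<le> k \<and> H = generate G S)"

text \<open>Every finite group is isomorphic to one on a set of natural numbers, so the type of
  \<open>K\<close> is no restriction; cf. the lemma after the definition.\<close>

definition separable_in :: "('a, 'b) monoid_scheme \<Rightarrow> 'a set \<Rightarrow> bool" where
  "separable_in G H \<longleftrightarrow> subgroup H G \<and>
    (\<forall>g \<in> carrier G - H. \<exists>(K :: nat monoid) \<psi>.
       group K \<and> finite (carrier K) \<and> \<psi> \<in> epi G K \<and> \<psi> g \<notin> \<psi> ` H)"

lemma finite_quotient_nat:
  fixes K :: "('c, 'd) monoid_scheme"
  assumes K: "group K" and fin: "finite (carrier K)" and \<psi>: "\<psi> \<in> epi G K"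
    and H: "H \<subseteq> carrier G" and g: "g \<in> carrier G" and sep: "\<psi> g \<notin> \<psi> ` H"
  shows "\<exists>(L :: nat monoid) \<phi>. group L \<and> finite (carrier L) \<and> \<phi> \<in> epi G L \<and> \<phi> g \<notin> \<phi> ` H"
proof -
  obtain f :: "'c \<Rightarrow> nat" where f: "inj_on f (carrier K)"
    using fin finite_imp_inj_to_nat_seg by metis
  let ?h = "inv_into (carrier K) f"
  define L :: "nat monoid" where
    "L = \<lparr>carrier = f ` carrier K, mult = (\<lambda>a b. f (?h a \<otimes>\<^bsub>K\<^esub> ?h b)), one = f \<one>\<^bsub>K\<^esub>\<rparr>"
  interpret K: group K by (rule K)
  have L: "group L"
  proof (rule groupI)
    show "\<exists>y\<in>carrier L. y \<otimes>\<^bsub>L\<^esub> x = \<one>\<^bsub>L\<^esub>" if "x \<in> carrier L" for x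
    proof -
      from that obtain a where a: "a \<in> carrier K" "x = f a" by (auto simp: L_def)
      then show ?thesis using f by (intro bexI[of _ "f (inv\<^bsub>K\<^esub> a)"]) (auto simp: L_def)
    qed
  qed (use f in \<open>auto simp: L_def K.m_assoc\<close>)
  have \<psi>': "\<psi> \<in> hom G K" "\<psi> ` carrier G = carrier K" using \<psi> by (auto simp: epi_def)
  have \<psi>c: "\<psi> x \<in> carrier K" if "x \<in> carrier G" for x using that \<psi>' by auto
  have "(f \<circ> \<psi>) \<in> epi G L"
    unfolding epi_def hom_def using f \<psi>' \<psi>c
    by (auto simp: L_def hom_mult) (metis image_eqI imageE)
  moreover have "(f \<circ> \<psi>) g \<notin> (f \<circ> \<psi>) ` H"
  proof
    assume "(f \<circ> \<psi>) g \<in> (f \<circ> \<psi>) ` H"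
    then obtain x where x: "x \<in> H" "f (\<psi> g) = f (\<psi> x)" by auto
    then have "\<psi> g = \<psi> x" using f \<psi>c g H by (meson inj_onD subsetD)
    with x sep show False by blast
  qed
  moreover have "finite (carrier L)" using fin by (simp add: L_def)
  ultimately show ?thesis using L by blast
qed

end

theory Submission
  imports Defs "HOL-Algebra.Bij"
begin

text \<open>
  Let \<open>H\<close> be generated by \<open>k\<close> elements, contain no conjugate of a generator, and let
  \<open>g \<notin> H\<close>. Consider finite connected graphs with edges labelled by the generators, mapped to the
  Schreier graph of \<open>H\<close>, of first Betti number at most \<open>k\<close>, whose loops at a base point represent
  generators of \<open>H\<close>, and in which some path from the base point represents the inverse of \<open>g\<close>.
  One with the fewest edges is folded; two vertices of an \<open>{i, j}\<close>-cycle in it have different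
  images, so the length of such a cycle divides \<open>2 m\<^sub>i\<^sub>j\<close>; and every \<open>{i, j}\<close>-path has at most
  \<open>2 m\<^sub>i\<^sub>j - 4\<close> edges, since otherwise a long arc of it could be traded for the at most three missing
  edges of the relator cycle. Now close every maximal \<open>{i, j}\<close>-path to a relator cycle
  by new vertices, where all cycles missing the same label at the same vertex share the new edge
  there. The remaining orbits of \<open>{i, j}\<close> have at most three points, three only if
  \<open>i\<close>, \<open>j\<close> and some third generator are pairwise related, so the divisibility assumptions make
  the group act on the finite result. The stabiliser of the base point contains \<open>H\<close> but not \<open>g\<close>.

  For the second part, the elements of even length in \<open>H\<close> form a subgroup of index at most two
  that needs at most \<open>2 l - 1 \<le> k\<close> generators and contains no conjugate of a generator.
\<close>

section \<open>Labelled graphs over a Schreier graph\<close>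

text \<open>The obstacle is that one label must serve many relators. Since \<open>l\<close> acts by
  a single permutation, the new \<open>l\<close>-edge at a vertex is shared by the cycles of all
  pairs containing \<open>l\<close>, so its far end lies on several cycles and is also moved by
  pairs \<open>{i, j}\<close> that do not contain \<open>l\<close>. Such an orbit stays short only
  if the neighbours of that end are private to one cycle, because a private vertex is fixed by every
  label foreign to its cycle. So a cycle needs two shared edges and at least two more around a
  private vertex: this is the 4 in \<open>2 m - 4\<close>. A foreign orbit is then a line with fixed
  ends, and two involutions that flip its consecutive edges alternately have a product whose order
  on it is the number of its points. The number \<open>3 k + 7\<close> comes from counting. Betti
  number \<open>k\<close> allows at most \<open>2 k\<close> special vertices (of degree above two,
  or one of the two marked ones) inside a path. The exchange needs three consecutive other vertices,
  as four deleted edges have to outweigh three added ones, and a path with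
  \<open>2 m - 3 \<ge> 6 k + 11\<close> edges has room for \<open>2 k + 1\<close> disjoint
  triples.\<close>

primrec walk :: "(nat \<times> nat \<times> nat) set \<Rightarrow> nat \<Rightarrow> nat list \<Rightarrow> nat \<Rightarrow> bool" where
  "walk E u [] v \<longleftrightarrow> u = v"
| "walk E u (i # w) v \<longleftrightarrow> (\<exists>u'. (u, i, u') \<in> E \<and> walk E u' w v)"

lemma walk_append: "walk E u (w @ w') v \<longleftrightarrow> (\<exists>x. walk E u w x \<and> walk E x w' v)"
  by (induction w arbitrary: u) auto

lemma walk_rev:
  assumes "\<And>u i w. (u, i, w) \<in> E \<Longrightarrow> (w, i, u) \<in> E" "walk E u w v"
  shows "walk E v (rev w) u"
  using assms(2) by (induction w arbitrary: u) (auto simp: walk_append intro: assms(1))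

lemma walk_map_upt:
  assumes "\<And>t. \<lbrakk>a \<le> t; t < b\<rbrakk> \<Longrightarrow> (x t, y t, x (Suc t)) \<in> E" "a \<le> b"
  shows "walk E (x a) (map y [a..<b]) (x b)"
  using assms(2,1)
proof (induction b rule: dec_induct)
  case base
  then show ?case by simp
next
  case (step b)
  then show ?case by (auto simp: walk_append)
qed

text \<open>An abstract right coset action: \<open>X\<close> is to be the set of right cosets of
  \<open>H\<close>, \<open>ev\<close> the value of a word in the group, and every letter is an
  involution. \<open>act_free\<close> is what the absence of conjugates of generators amounts to; it
  keeps loops out of the graphs.\<close>

locale word_action =
  fixes I :: "nat set" and ev :: "nat list \<Rightarrow> 'g" and X :: "'c set" and act :: "'c \<Rightarrow> nat \<Rightarrow> 'c"
  assumes ev_append: "\<lbrakk>ev u = ev u'; ev v = ev v'\<rbrakk> \<Longrightarrow> ev (u @ v) = ev (u' @ v')"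
    and ev_sq: "ev [i, i] = ev []"
    and act_closed: "c \<in> X \<Longrightarrow> act c i \<in> X"
    and act_ev: "\<lbrakk>c \<in> X; ev u = ev v\<rbrakk> \<Longrightarrow> foldl act c u = foldl act c v"
    and act_free: "\<lbrakk>c \<in> X; i \<in> I\<rbrakk> \<Longrightarrow> act c i \<noteq> c"
begin

lemma ev_cong3: "ev v = ev v' \<Longrightarrow> ev (u @ v @ w) = ev (u @ v' @ w)"
  by (intro ev_append) auto

lemma ev_rev_right: "ev (w @ rev w) = ev []"
proof (induction w)
  case (Cons i w)
  have "ev ((i # w) @ rev (i # w)) = ev ([i] @ (w @ rev w) @ [i])" by simp
  also have "\<dots> = ev ([i] @ [] @ [i])" by (intro ev_cong3 Cons)
  finally show ?case by (simp add: ev_sq)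
qed simp

lemma ev_rev_left: "ev (rev w @ w) = ev []"
  using ev_rev_right[of "rev w"] by simp

lemma ev_rev_cong:
  assumes "ev u = ev v"
  shows "ev (rev u) = ev (rev v)"
proof -
  have "ev (rev u) = ev (rev u @ (v @ rev v))"
    using ev_append[OF HOL.refl ev_rev_right, of "rev u" v] by simp
  also have "\<dots> = ev (rev u @ (u @ rev v))"
    by (intro ev_append HOL.refl) (simp add: assms)
  also have "\<dots> = ev ((rev u @ u) @ rev v)" by simp
  also have "\<dots> = ev ([] @ rev v)" by (intro ev_append ev_rev_left HOL.refl)
  finally show ?thesis by simp
qed

text \<open>Only the group element read along the walk counts, so that a walk may be rerouted around
  a relator cycle.\<close>

definition conn :: "(nat \<times> nat \<times> nat) set \<Rightarrow> nat \<Rightarrow> nat list \<Rightarrow> nat \<Rightarrow> bool" where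
  "conn E u w v \<longleftrightarrow> (\<exists>w'. ev w' = ev w \<and> walk E u w' v)"

lemma conn_walk: "walk E u w v \<Longrightarrow> conn E u w v"
  unfolding conn_def by blast

lemma conn_ev: "conn E u w v \<Longrightarrow> ev w = ev w' \<Longrightarrow> conn E u w' v"
  unfolding conn_def by auto

lemma conn_append: "conn E u w v \<Longrightarrow> conn E v w' x \<Longrightarrow> conn E u (w @ w') x"
  unfolding conn_def using ev_append walk_append by metis

lemma conn_rev:
  assumes "\<And>u i w. (u, i, w) \<in> E \<Longrightarrow> (w, i, u) \<in> E" "conn E u w v"
  shows "conn E v (rev w) u"
  using assms walk_rev ev_rev_cong unfolding conn_def by blast

lemma act_act: "c \<in> X \<Longrightarrow> act (act c i) i = c"
  using act_ev[of c "[i, i]" "[]"] ev_sq by simp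

section \<open>Finite graphs over the Schreier graph and their modifications\<close>

definition lgraph :: "nat set \<Rightarrow> (nat \<times> nat \<times> nat) set \<Rightarrow> (nat \<Rightarrow> 'c) \<Rightarrow> bool" where
  "lgraph V E \<phi> \<longleftrightarrow> finite V \<and> E \<subseteq> V \<times> I \<times> V \<and> \<phi> ` V \<subseteq> X \<and>
     (\<forall>u i w. (u, i, w) \<in> E \<longrightarrow> (w, i, u) \<in> E \<and> \<phi> w = act (\<phi> u) i)"

text \<open>As \<open>E\<close> contains both orientations of every edge, the cardinality bound
  says that the first Betti number of the graph is at most \<open>k\<close>.\<close>

definition valid :: "nat \<Rightarrow> nat list set \<Rightarrow> nat list \<Rightarrow> 'c \<Rightarrow> nat set \<Rightarrow> (nat \<times> nat \<times> nat) set \<Rightarrow>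
    (nat \<Rightarrow> 'c) \<Rightarrow> nat \<Rightarrow> nat \<Rightarrow> bool" where
  "valid k T g c V E \<phi> a b \<longleftrightarrow> lgraph V E \<phi> \<and> a \<in> V \<and> \<phi> a = c \<and>
     (\<forall>v\<in>V. \<exists>w. walk E a w v) \<and> (\<forall>w\<in>T. conn E a w a) \<and> conn E a g b \<and>
     card E + 2 \<le> 2 * card V + 2 * k"

lemma validD:
  assumes "valid k T g c V E \<phi> a b"
  shows "lgraph V E \<phi>" "a \<in> V" "\<phi> a = c" "v \<in> V \<Longrightarrow> \<exists>w. walk E a w v"
    "w \<in> T \<Longrightarrow> conn E a w a" "conn E a g b" "card E + 2 \<le> 2 * card V + 2 * k"
  using assms unfolding valid_def by simp_all

lemma lgraphD:
  assumes "lgraph V E \<phi>"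
  shows "finite V" "E \<subseteq> V \<times> I \<times> V" "(u, i, w) \<in> E \<Longrightarrow> (w, i, u) \<in> E"
    "(u, i, w) \<in> E \<Longrightarrow> \<phi> w = act (\<phi> u) i" "v \<in> V \<Longrightarrow> \<phi> v \<in> X"
    "(u, i, w) \<in> E \<Longrightarrow> u \<in> V" "(u, i, w) \<in> E \<Longrightarrow> w \<in> V" "(u, i, w) \<in> E \<Longrightarrow> i \<in> I"
  using assms unfolding lgraph_def by blast+

lemma lgraph_no_loop: "lgraph V E \<phi> \<Longrightarrow> (u, i, w) \<in> E \<Longrightarrow> u \<noteq> w"
  using lgraphD[of V E \<phi>] act_free by metis

lemma lgraph_walk_end: "lgraph V E \<phi> \<Longrightarrow> walk E u w v \<Longrightarrow> u \<in> V \<Longrightarrow> v \<in> V"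
  by (induction w arbitrary: u) (auto dest: lgraphD)

lemma lgraph_walk_foldl:
  "lgraph V E \<phi> \<Longrightarrow> walk E u w v \<Longrightarrow> \<phi> v = foldl act (\<phi> u) w"
  by (induction w arbitrary: u) (auto dest: lgraphD(4))

lemma finite_lgraph_edges:
  assumes "lgraph V E \<phi>" "finite I"
  shows "finite E"
  using finite_subset[OF lgraphD(2)[OF assms(1)]] lgraphD(1)[OF assms(1)] assms(2) by blast

text \<open>\<open>\<kappa> v\<close> is to be thought of as the label of a path from
  \<open>v\<close> to its new place \<open>r v\<close>. An edge \<open>(u, i, w)\<close> then
  becomes the way back from \<open>r u\<close> to \<open>u\<close>, across \<open>i\<close>, and out
  to \<open>r w\<close>; along a walk the consecutive detours cancel. As \<open>\<kappa>\<close> is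
  empty at \<open>a\<close> and \<open>b\<close>, words read between these keep their
  values.\<close>

lemma valid_transfer:
  assumes v: "valid k T g c V E \<phi> a b"
    and L': "lgraph V' E' \<phi>'"
    and bound: "card E' + 2 \<le> 2 * card V' + 2 * k'"
    and r: "r ` V \<subseteq> V'" "\<phi>' (r a) = \<phi> a" "\<kappa> a = []" "\<kappa> b = []"
    and edges: "\<And>u i w. (u, i, w) \<in> E \<Longrightarrow> conn E' (r u) (rev (\<kappa> u) @ [i] @ \<kappa> w) (r w)"
    and reach: "\<And>v'. v' \<in> V' \<Longrightarrow> \<exists>v\<in>V. \<exists>w. walk E' (r v) w v'"
  shows "valid k' T g c V' E' \<phi>' (r a) (r b)"
proof -
  have *: "conn E' (r u) (rev (\<kappa> u) @ w @ \<kappa> v) (r v)" if "walk E u w v" for u w v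
    using that
  proof (induction w arbitrary: u)
    case Nil
    then show ?case using conn_ev[OF conn_walk[of E' "r u" "[]" "r u"]] ev_rev_left by simp
  next
    case (Cons i w)
    then obtain u' where u': "(u, i, u') \<in> E" "walk E u' w v" by auto
    have "conn E' (r u) ((rev (\<kappa> u) @ [i] @ \<kappa> u') @ rev (\<kappa> u') @ w @ \<kappa> v) (r v)"
      using conn_append[OF edges[OF u'(1)] Cons.IH[OF u'(2)]] .
    moreover have "ev ((rev (\<kappa> u) @ [i]) @ (\<kappa> u' @ rev (\<kappa> u')) @ w @ \<kappa> v) =
        ev ((rev (\<kappa> u) @ [i]) @ [] @ w @ \<kappa> v)"
      by (intro ev_cong3 ev_rev_right)
    ultimately show ?case by (auto elim: conn_ev)
  qed
  have **: "conn E' (r a) (w @ \<kappa> v) (r v)" if "conn E a w v" for w v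
  proof -
    from that obtain w' where "ev w' = ev w" "walk E a w' v" unfolding conn_def by blast
    with *[of a w' v] r show ?thesis by (auto elim!: conn_ev intro: ev_append)
  qed
  have "\<exists>w. walk E' (r a) w v'" if v': "v' \<in> V'" for v'
  proof -
    obtain x w where x: "x \<in> V" "walk E' (r x) w v'" using reach[OF v'] by blast
    then obtain w1 where "walk E a w1 x" using v unfolding valid_def by blast
    then obtain w2 where "walk E' (r a) w2 (r x)" using *[of a w1 x] unfolding conn_def by blast
    with x show ?thesis using walk_append by blast
  qed
  moreover have "conn E' (r a) g (r b)" using **[OF validD(6)[OF v]] r by simp
  moreover have "conn E' (r a) w (r a)" if "w \<in> T" for w
    using **[OF validD(5)[OF v that]] r by simp
  ultimately show ?thesis using validD(2,3)[OF v] L' bound r unfolding valid_def by auto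
qed

lemma lgraph_image:
  assumes L: "lgraph V E \<phi>" and f: "f ` V \<subseteq> V" "\<And>v. v \<in> V \<Longrightarrow> \<phi> (f v) = \<phi> v"
  shows "lgraph (f ` V) ((\<lambda>(u, i, w). (f u, i, f w)) ` E) \<phi>"
proof -
  have "(f w, i, f u) \<in> (\<lambda>(u, i, w). (f u, i, f w)) ` E" "\<phi> (f w) = act (\<phi> (f u)) i"
    if "(u, i, w) \<in> E" for u i w
    using f(2) lgraphD(3,4,6,7)[OF L that] by (force, simp)
  moreover have "(\<lambda>(u, i, w). (f u, i, f w)) ` E \<subseteq> f ` V \<times> I \<times> f ` V"
    using lgraphD(2)[OF L] by auto
  ultimately show ?thesis using lgraphD(1,5)[OF L] f(1)
    unfolding lgraph_def by auto
qed

lemma valid_image: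
  assumes v: "valid k T g c V E \<phi> a b"
    and f: "f ` V \<subseteq> V" "\<And>v. v \<in> V \<Longrightarrow> \<phi> (f v) = \<phi> v"
    and bound: "card ((\<lambda>(u, i, w). (f u, i, f w)) ` E) + 2 \<le> 2 * card (f ` V) + 2 * k'"
  shows "valid k' T g c (f ` V) ((\<lambda>(u, i, w). (f u, i, f w)) ` E) \<phi> (f a) (f b)"
proof (rule valid_transfer[OF v _ bound, where r = f and \<kappa> = "\<lambda>_. []"])
  have L: "lgraph V E \<phi>" "a \<in> V" using validD[OF v] by simp_all
  show "lgraph (f ` V) ((\<lambda>(u, i, w). (f u, i, f w)) ` E) \<phi>" by (rule lgraph_image[OF L(1) f])
  show "\<phi> (f a) = \<phi> a" using L f by simp
  show "conn ((\<lambda>(u, i, w). (f u, i, f w)) ` E) (f u) (rev [] @ [i] @ []) (f w)"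
    if "(u, i, w) \<in> E" for u i w
    using that by (intro conn_walk) force
  show "\<exists>v\<in>V. \<exists>w. walk ((\<lambda>(u, i, w). (f u, i, f w)) ` E) (f v) w v'" if "v' \<in> f ` V" for v'
    using that walk.simps(1) by blast
qed auto

lemma walk_of_image:
  "walk E u w v \<Longrightarrow> walk ((\<lambda>(u, i, w). (f u, i, f w)) ` E) (f u) w (f v)"
  by (induction w arbitrary: u) force+

text \<open>A pendant edge adds one vertex and two triples, so the cardinality bound
  survives.\<close>

lemma valid_add_edge:
  assumes v: "valid k T g c V E \<phi> a b" and x: "x \<in> V" "i \<in> I" and z: "z \<notin> V"
  shows "valid k T g c (insert z V) (E \<union> {(x, i, z), (z, i, x)}) (\<phi>(z := act (\<phi> x) i)) a b"
proof -
  let ?E = "E \<union> {(x, i, z), (z, i, x)}"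
  have L: "lgraph V E \<phi>" "a \<in> V" using validD[OF v] by simp_all
  have xz: "x \<noteq> z" using x z by auto
  have nz: "u \<noteq> z" "w \<noteq> z" if "(u, j, w) \<in> E" for u j w
    using lgraphD(6,7)[OF L(1) that] z by auto
  have "valid k T g c (insert z V) ?E (\<phi>(z := act (\<phi> x) i)) (id a) (id b)"
  proof (rule valid_transfer[OF v, where r = id and \<kappa> = "\<lambda>_. []"])
    show "lgraph (insert z V) ?E (\<phi>(z := act (\<phi> x) i))"
      unfolding lgraph_def
    proof (intro conjI allI impI)
      show "finite (insert z V)" using lgraphD(1)[OF L(1)] by simp
      show "?E \<subseteq> insert z V \<times> I \<times> insert z V" using lgraphD(2)[OF L(1)] x by auto
      show "(\<phi>(z := act (\<phi> x) i)) ` insert z V \<subseteq> X"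
        using lgraphD(5)[OF L(1)] act_closed x by auto
      fix u j w assume "(u, j, w) \<in> ?E"
      then show "(w, j, u) \<in> ?E" "(\<phi>(z := act (\<phi> x) i)) w = act ((\<phi>(z := act (\<phi> x) i)) u) j"
        using lgraphD(3,4)[OF L(1), of u j w] nz[of u j w] xz act_act lgraphD(5)[OF L(1) x(1)] by auto
    qed
    have "card ?E \<le> card E + card {(x, i, z), (z, i, x)}" by (rule card_Un_le)
    also have "\<dots> \<le> card E + 2" using xz by simp
    finally show "card ?E + 2 \<le> 2 * card (insert z V) + 2 * k"
      using validD(7)[OF v] z lgraphD(1)[OF L(1)] by simp
    show "(\<phi>(z := act (\<phi> x) i)) (id a) = \<phi> a" using L z by auto
    show "conn ?E (id u) (rev [] @ [j] @ []) (id w)" if "(u, j, w) \<in> E" for u j w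
      by (rule conn_walk) (use that in simp)
    show "\<exists>v\<in>V. \<exists>w. walk ?E (id v) w v'" if "v' \<in> insert z V" for v'
    proof (cases "v' = z")
      case True
      then have "walk ?E (id x) [i] v'" by simp
      then show ?thesis using x(1) by blast
    next
      case False
      then have "walk ?E (id v') [] v'" by simp
      moreover have "v' \<in> V" using that False by simp
      ultimately show ?thesis by blast
    qed
  qed auto
  then show ?thesis by simp
qed

text \<open>Every letter adds a fresh pendant edge, even where an edge with that label is available;
  folding is left to minimality.\<close>

lemma valid_trace:
  assumes "valid k T g c V E \<phi> a b" "x \<in> V" "w \<in> lists I"
  shows "\<exists>V' E' \<phi>' z. valid k T g c V' E' \<phi>' a b \<and> E \<subseteq> E' \<and> walk E' x w z"
  using assms
proof (induction w arbitrary: x V E \<phi>)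
  case Nil
  then show ?case by auto
next
  case (Cons i w)
  have "finite V" using validD(1)[OF Cons.prems(1)] lgraphD(1) by blast
  then obtain z where z: "z \<notin> V" using ex_new_if_finite infinite_UNIV_nat by blast
  have v: "valid k T g c (insert z V) (E \<union> {(x, i, z), (z, i, x)}) (\<phi>(z := act (\<phi> x) i)) a b"
    using valid_add_edge[OF Cons.prems(1,2) _ z] Cons.prems(3) by auto
  obtain V' E' \<phi>' y where *: "valid k T g c V' E' \<phi>' a b"
    "E \<union> {(x, i, z), (z, i, x)} \<subseteq> E'" "walk E' z w y"
    using Cons.IH[OF v, of z] Cons.prems(3) by (metis Cons_in_lists_iff insertI1)
  then have "walk E' x (i # w) y" by auto
  with * show ?case by blast
qed

text \<open>The word is traced from \<open>a\<close> along fresh edges; the end of the trace lies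
  over \<open>c\<close> and is glued to \<open>a\<close>. This loses at most one vertex, which
  raises the permitted Betti number by one.\<close>

lemma valid_add_loop:
  assumes v: "valid k T g c V E \<phi> a b" and w: "w \<in> lists I" "foldl act c w = c"
    and fin: "finite I"
  shows "\<exists>V' E' \<phi>' a' b'. valid (Suc k) (insert w T) g c V' E' \<phi>' a' b'"
proof -
  have "a \<in> V" using v unfolding valid_def by blast
  then obtain V' E' \<phi>' z where *: "valid k T g c V' E' \<phi>' a b" "walk E' a w z"
    using valid_trace[OF v _ w(1)] by blast
  have L: "lgraph V' E' \<phi>'" "a \<in> V'" "\<phi>' a = c" "card E' + 2 \<le> 2 * card V' + 2 * k"
    using validD[OF *(1)] by simp_all
  have z: "z \<in> V'" "\<phi>' z = c"
    using lgraph_walk_end[OF L(1) *(2)] lgraph_walk_foldl[OF L(1) *(2)] L w by auto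
  let ?f = "\<lambda>v. if v = z then a else v"
  let ?F = "\<lambda>(u, i, w). (?f u, i, ?f w)"
  have "V' - {z} \<subseteq> ?f ` V'" by auto
  then have "card (V' - {z}) \<le> card (?f ` V')" using lgraphD(1)[OF L(1)] by (intro card_mono) auto
  then have cV: "card V' \<le> card (?f ` V') + 1" using z lgraphD(1)[OF L(1)] by (simp add: card_Diff_singleton)
  have cE: "card (?F ` E') \<le> card E'"
    by (rule card_image_le[OF finite_lgraph_edges[OF L(1) fin]])
  have "valid (Suc k) T g c (?f ` V') (?F ` E') \<phi>' (?f a) (?f b)"
    using *(1) by (rule valid_image) (use L z cE cV in auto)
  moreover have "conn (?F ` E') (?f a) w (?f a)"
    using walk_of_image[OF *(2), of ?f] by (intro conn_walk) auto
  ultimately have "valid (Suc k) (insert w T) g c (?f ` V') (?F ` E') \<phi>' (?f a) (?f b)"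
    unfolding valid_def by simp
  then show ?thesis by blast
qed

lemma valid_exists:
  assumes c: "c \<in> X" and g: "g \<in> lists I" and fin: "finite T" "finite I"
    and T: "\<And>w. w \<in> T \<Longrightarrow> w \<in> lists I \<and> foldl act c w = c"
  shows "\<exists>V E \<phi> a b. valid (card T) T g c V E \<phi> a b"
  using fin(1) T
proof (induction T rule: finite_induct)
  case empty
  have "valid 0 {} [] c {0} {} (\<lambda>_. c) 0 0"
    using c unfolding valid_def lgraph_def by (auto intro!: conn_walk exI[of _ "[]"])
  from valid_trace[OF this _ g, of 0] obtain V' E' \<phi>' z
    where "valid 0 {} [] c V' E' \<phi>' 0 0" "walk E' 0 g z" by auto
  then have "valid 0 {} g c V' E' \<phi>' 0 z" unfolding valid_def by (auto intro: conn_walk)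
  then show ?case unfolding card.empty by blast
next
  case (insert w T)
  then obtain V E \<phi> a b where "valid (card T) T g c V E \<phi> a b" by blast
  from valid_add_loop[OF this, of w] insert fin show ?case by simp
qed

lemma valid_minimal_exists:
  assumes "valid k T g c V0 E0 \<phi>0 a0 b0"
  shows "\<exists>V E \<phi> a b. valid k T g c V E \<phi> a b \<and>
    (\<forall>V' E' \<phi>' a' b'. valid k T g c V' E' \<phi>' a' b' \<longrightarrow> card E \<le> card E')"
proof -
  let ?Q = "\<lambda>N. \<exists>V E \<phi> a b. valid k T g c V E \<phi> a b \<and> card E = N"
  have "?Q (card E0)" using assms by blast
  then have "?Q (LEAST N. ?Q N)" by (rule LeastI)
  moreover have "(LEAST N. ?Q N) \<le> card E'" if "valid k T g c V' E' \<phi>' a' b'" for V' E' \<phi>' a' b'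
    by (rule Least_le) (use that in blast)
  ultimately show ?thesis by metis
qed

end

lemma map_alternating_upt:
  "map (\<lambda>t. if even t then i else j) [0..<2 * p] = concat (replicate p [i, j])"
proof (induction p)
  case (Suc p)
  have "concat (replicate p [i, j]) @ [i, j] = [i, j] @ concat (replicate p [i, j])" for p
    by (induction p) auto
  with Suc show ?case by simp
qed simp

section \<open>Consequences of having the fewest edges\<close>

locale minimal_graph = word_action I ev X act
  for I :: "nat set" and ev :: "nat list \<Rightarrow> 'g" and X :: "'c set" and act +
  fixes k :: nat and T :: "nat list set" and g :: "nat list" and c :: 'c
    and V :: "nat set" and E :: "(nat \<times> nat \<times> nat) set" and \<phi> :: "nat \<Rightarrow> 'c" and a b :: nat
  assumes finite_I: "finite I"
    and val: "valid k T g c V E \<phi> a b"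
    and minimal: "\<And>V' E' \<phi>' a' b'. valid k T g c V' E' \<phi>' a' b' \<Longrightarrow> card E \<le> card E'"
    and g_moves: "foldl act c g \<noteq> c"
begin

lemma L: "lgraph V E \<phi>" using validD(1)[OF val] .

lemmas fin_V = lgraphD(1)[OF L] and edge_sym = lgraphD(3)[OF L] and edge_act = lgraphD(4)[OF L]
  and X_vertex = lgraphD(5)[OF L] and edge_V = lgraphD(6,7)[OF L] and edge_I = lgraphD(8)[OF L]
  and no_loop = lgraph_no_loop[OF L] and fin_E = finite_lgraph_edges[OF L finite_I]

lemma a_V: "a \<in> V" and b_V: "b \<in> V" and a_neq_b: "a \<noteq> b"
proof -
  show a: "a \<in> V" using validD(2)[OF val] .
  obtain w where w: "ev w = ev g" "walk E a w b"
    using validD(6)[OF val] unfolding conn_def by blast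
  show "b \<in> V" using lgraph_walk_end[OF L w(2) a] .
  have "\<phi> b = foldl act (\<phi> a) g"
    using lgraph_walk_foldl[OF L w(2)] act_ev[OF X_vertex[OF a] w(1)] by simp
  then show "a \<noteq> b" using g_moves validD(3)[OF val] by auto
qed

lemma no_smaller_image:
  assumes f: "f ` V \<subseteq> V" "\<And>v. v \<in> V \<Longrightarrow> \<phi> (f v) = \<phi> v"
    and bound: "card ((\<lambda>(u, i, w). (f u, i, f w)) ` E) + 2 \<le> 2 * card (f ` V) + 2 * k"
  shows "card E \<le> card ((\<lambda>(u, i, w). (f u, i, f w)) ` E)"
  using minimal[OF valid_image[OF val f bound]] .

text \<open>Identifying the ends of two equally labelled edges at \<open>u\<close> removes one
  vertex and at least one edge, so the Betti number does not grow while the number of edges drops.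
  Both ends have the same image in the Schreier graph, so the map to it survives.\<close>

lemma folded:
  assumes e: "(u, i, w) \<in> E" "(u, i, w') \<in> E"
  shows "w = w'"
proof (rule ccontr)
  assume ne: "w \<noteq> w'"
  let ?f = "\<lambda>v. if v = w' then w else v"
  let ?F = "\<lambda>(u, i, w). (?f u, i, ?f w)"
  let ?D = "{(u, i, w'), (w', i, u)}"
  have nl: "u \<noteq> w" "u \<noteq> w'" using no_loop e by auto
  \<comment> \<open>After the identification, the two orientations of the second edge coincide with
    those of the first.\<close>
  have "?F ` E \<subseteq> ?F ` (E - ?D)"
  proof
    fix z assume "z \<in> ?F ` E"
    then obtain s where s: "s \<in> E" "z = ?F s" by blast
    show "z \<in> ?F ` (E - ?D)"
    proof (cases "s \<in> ?D")
      case False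
      with s show ?thesis by blast
    next
      case True
      then consider "s = (u, i, w')" | "s = (w', i, u)" by blast
      then have "z = ?F (u, i, w) \<or> z = ?F (w, i, u)" using s(2) nl by cases auto
      moreover have "(u, i, w) \<in> E - ?D" "(w, i, u) \<in> E - ?D"
        using e(1) edge_sym[OF e(1)] ne nl by auto
      ultimately show ?thesis by blast
    qed
  qed
  then have "card (?F ` E) \<le> card (E - ?D)"
    using card_mono[of "?F ` (E - ?D)"] card_image_le[of "E - ?D" ?F] fin_E
    by (meson finite_Diff finite_imageI le_trans)
  also have "\<dots> = card E - 2"
    using nl e(2) edge_sym[OF e(2)] fin_E by (subst card_Diff_subset) auto
  finally have cE: "card (?F ` E) \<le> card E - 2" .
  have "card {(u, i, w), (w, i, u)} \<le> card E"
    using e(1) edge_sym[OF e(1)] by (intro card_mono fin_E) auto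
  then have cE2: "2 \<le> card E" using nl by simp
  have w: "w \<in> V" "w' \<in> V" using edge_V(2) e by auto
  have "?f ` V = V - {w'}" using ne w by auto
  then have cV: "card (?f ` V) = card V - 1" using w fin_V by simp
  moreover have "card V > 0" using w fin_V card_gt_0_iff by blast
  ultimately have "card (?F ` E) + 2 \<le> 2 * card (?f ` V) + 2 * k"
    using cE cE2 validD(7)[OF val] by linarith
  moreover have "\<phi> w' = \<phi> w" using edge_act e by simp
  ultimately have "card E \<le> card (?F ` E)"
    by (intro no_smaller_image) (use w in auto)
  with cE cE2 show False by linarith
qed

text \<open>\<open>C\<close> is a union of closed \<open>{i, j}\<close>-cycles. Collapsing its
  vertices with equal images leaves at most two triples for each remaining vertex of
  \<open>C\<close>, because image and label determine the image of the target. At least two triples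
  disappear with every vertex, so the Betti number does not grow.\<close>

lemma inj_on_closed:
  assumes C: "C \<subseteq> V" and ij: "i \<noteq> j"
    and closed: "\<And>x y. x \<in> C \<Longrightarrow> y \<in> {i, j} \<Longrightarrow> \<exists>x'\<in>C. (x, y, x') \<in> E"
  shows "inj_on \<phi> C"
proof (rule ccontr)
  assume ninj: "\<not> inj_on \<phi> C"
  define f where "f v = (if v \<in> C then inv_into C \<phi> (\<phi> v) else v)" for v
  let ?F = "\<lambda>(u, i, w). (f u, i, f w)"
  have fC: "f v \<in> C" "\<phi> (f v) = \<phi> v" if "v \<in> C" for v
    using that by (auto simp: f_def inv_into_into f_inv_into_f)
  have f_eq: "f u = f v \<longleftrightarrow> \<phi> u = \<phi> v" if "u \<in> C" "v \<in> C" for u v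
    using fC that f_def by metis
  have finC: "finite C" using C fin_V finite_subset by blast
  define EC where "EC = {(u, s, w) \<in> E. u \<in> C \<and> s \<in> {i, j}}"
  have EC: "EC \<subseteq> E" "finite EC" using fin_E unfolding EC_def by (auto intro: finite_subset[of _ E])
  have tgt: "w \<in> C" if "(u, s, w) \<in> EC" for u s w
  proof -
    have "u \<in> C" "s \<in> {i, j}" "(u, s, w) \<in> E" using that unfolding EC_def by auto
    with closed[of u s] show ?thesis using folded by blast
  qed
  let ?pr = "\<lambda>(u, s, w). (u, s)"
  have "?pr ` EC = C \<times> {i, j}" using closed unfolding EC_def by force
  moreover have "inj_on ?pr EC" using folded unfolding EC_def inj_on_def by auto
  ultimately have cEC: "card EC = 2 * card C"
    using card_image[of ?pr EC] ij finC by (simp add: card_cartesian_product)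
  have "inj_on ?pr (?F ` EC)"
  proof (rule inj_onI)
    fix e e' assume e: "e \<in> ?F ` EC" "e' \<in> ?F ` EC" "?pr e = ?pr e'"
    obtain u s w where 1: "(u, s, w) \<in> EC" "e = (f u, s, f w)" using e(1) by force
    obtain u' s' w' where 2: "(u', s', w') \<in> EC" "e' = (f u', s', f w')" using e(2) by force
    have "s = s'" "f u = f u'" using e(3) 1 2 by auto
    moreover from this have "\<phi> u = \<phi> u'" using f_eq 1 2 unfolding EC_def by auto
    ultimately have "\<phi> w = \<phi> w'" using edge_act 1 2 unfolding EC_def by auto
    then have "f w = f w'" using f_eq tgt 1 2 by blast
    with 1 2 \<open>s = s'\<close> \<open>f u = f u'\<close> show "e = e'" by simp
  qed
  moreover have "?pr ` ?F ` EC \<subseteq> f ` C \<times> {i, j}" unfolding EC_def by auto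
  ultimately have "card (?F ` EC) \<le> card (f ` C \<times> {i, j})"
    using finC by (intro card_inj_on_le[of ?pr]) auto
  then have cFEC: "card (?F ` EC) \<le> 2 * card (f ` C)"
    using ij by (simp add: card_cartesian_product)
  have "?F ` E = ?F ` (E - EC) \<union> ?F ` EC" using EC by blast
  then have "card (?F ` E) \<le> card (?F ` (E - EC)) + card (?F ` EC)" by (simp add: card_Un_le)
  also have "\<dots> \<le> card (E - EC) + 2 * card (f ` C)"
    using card_image_le[of "E - EC" ?F] fin_E cFEC by (intro add_mono) auto
  finally have cE: "card (?F ` E) \<le> card E - 2 * card C + 2 * card (f ` C)"
    using EC cEC by (simp add: card_Diff_subset)
  have cE2: "2 * card C \<le> card E" using card_mono[OF fin_E EC(1)] cEC by simp
  have fsub: "f ` C \<subseteq> C" using fC by blast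
  moreover have "f ` C \<noteq> C"
  proof
    assume "f ` C = C"
    then have "inj_on f C" using eq_card_imp_inj_on[OF finC, of f] by simp
    then show False using ninj f_eq unfolding inj_on_def by blast
  qed
  ultimately have lt: "card (f ` C) < card C" using finC by (simp add: psubset_card_mono psubsetI)
  have "f ` V = (V - C) \<union> f ` C" using C unfolding f_def by auto
  moreover have "(V - C) \<inter> f ` C = {}" using fsub by blast
  ultimately have "card (f ` V) = card (V - C) + card (f ` C)"
    using fin_V finC by (simp add: card_Un_disjoint)
  then have cV: "card (f ` V) = card V - card C + card (f ` C)"
    using finC C by (simp add: card_Diff_subset)
  have "card C \<le> card V" using C fin_V card_mono by blast
  then have "card (?F ` E) + 2 \<le> 2 * card (f ` V) + 2 * k"
    using cE cE2 cV validD(7)[OF val] by linarith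
  then have "card E \<le> card (?F ` E)"
    by (intro no_smaller_image) (use fC C in \<open>auto simp: f_def\<close>)
  with cE cE2 lt show False by linarith
qed

section \<open>Degrees of vertices\<close>

definition outs :: "nat \<Rightarrow> (nat \<times> nat \<times> nat) set" where
  "outs v = {e \<in> E. fst e = v}"

lemma finite_outs: "finite (outs v)"
  using fin_E unfolding outs_def by simp

lemma sum_card_outs: "(\<Sum>v\<in>V. card (outs v)) = card E"
proof -
  have "E = (\<Union>v\<in>V. outs v)" using edge_V(1) unfolding outs_def by force
  moreover have "card (\<Union>v\<in>V. outs v) = (\<Sum>v\<in>V. card (outs v))"
    using fin_V finite_outs by (intro card_UN_disjoint) (auto simp: outs_def)
  ultimately show ?thesis by simp
qed

lemma ex_out:
  assumes "v \<in> V"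
  shows "\<exists>i u. (v, i, u) \<in> E"
proof -
  have "\<exists>w u. walk E v w u \<and> u \<noteq> v"
  proof (cases "v = a")
    case True
    then show ?thesis using validD(6)[OF val] a_neq_b unfolding conn_def by auto
  next
    case False
    obtain w where "walk E a w v" using validD(4)[OF val assms] by blast
    then show ?thesis using walk_rev[of E a w v] edge_sym False by blast
  qed
  then obtain w u where "walk E v w u" "u \<noteq> v" by blast
  then show ?thesis by (cases w) auto
qed

text \<open>A leaf other than \<open>a\<close> and \<open>b\<close> can be pruned: a walk through it
  turns back along the same edge, and the two letters cancel.\<close>

lemma not_leaf:
  assumes v: "v \<in> V" "v \<noteq> a" "v \<noteq> b"
  shows "2 \<le> card (outs v)"
proof (rule ccontr)
  assume less: "\<not> 2 \<le> card (outs v)"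
  obtain i u where e: "(v, i, u) \<in> E" using ex_out[OF v(1)] by blast
  have "outs v = {(v, i, u)}"
  proof (rule card_seteq[symmetric, OF finite_outs])
    show "{(v, i, u)} \<subseteq> outs v" using e unfolding outs_def by simp
    show "card (outs v) \<le> card {(v, i, u)}" using less by simp
  qed
  then have only: "j = i \<and> w = u" if "(v, j, w) \<in> E" for j w
    using that unfolding outs_def by (metis (mono_tags, lifting) fst_conv mem_Collect_eq prod.inject singletonD)
  have nl: "u \<noteq> v" using no_loop[OF e] by simp
  have u: "u \<in> V" using edge_V(2)[OF e] .
  let ?D = "{(v, i, u), (u, i, v)}"
  have D: "?D \<subseteq> E" using e edge_sym by auto
  have "card ?D = 2" using nl by simp
  then have cE: "card (E - ?D) = card E - 2" "2 \<le> card E"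
    using D fin_E card_mono[OF fin_E D] by (simp_all add: card_Diff_subset)
  have cV: "card (V - {v}) = card V - 1" "card V > 0" using v fin_V card_gt_0_iff by auto
  \<comment> \<open>The leaf retracts to its only neighbour; \<open>[i]\<close> is the label of the
    way there.\<close>
  define r where "r = id(v := u)"
  define \<kappa> where "\<kappa> = (\<lambda>_. [])(v := [i])"
  have "valid k T g c (V - {v}) (E - ?D) \<phi> (r a) (r b)"
  proof (rule valid_transfer[OF val, where \<kappa> = \<kappa>])
    have "E - ?D \<subseteq> (V - {v}) \<times> I \<times> (V - {v})"
    proof (rule subrelI, clarsimp)
      fix s j t assume st: "(s, j, t) \<in> E" "s = v \<longrightarrow> j = i \<longrightarrow> t \<noteq> u" "s = u \<longrightarrow> j = i \<longrightarrow> t \<noteq> v"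
      then have "s \<noteq> v" "t \<noteq> v" using only[of j t] only[of j s] edge_sym[OF st(1)] by blast+
      then show "s \<in> V \<and> s \<noteq> v \<and> j \<in> I \<and> t \<in> V \<and> t \<noteq> v" using edge_V edge_I st by blast
    qed
    then show "lgraph (V - {v}) (E - ?D) \<phi>"
      unfolding lgraph_def using fin_V X_vertex edge_sym edge_act by blast
    show "card (E - ?D) + 2 \<le> 2 * card (V - {v}) + 2 * k"
      using cE cV validD(7)[OF val] by linarith
    show "r ` V \<subseteq> V - {v}" using u nl unfolding r_def by auto
    show "\<phi> (r a) = \<phi> a" "\<kappa> a = []" "\<kappa> b = []" using v unfolding r_def \<kappa>_def by auto
    show "conn (E - ?D) (r s) (rev (\<kappa> s) @ [j] @ \<kappa> t) (r t)" if st: "(s, j, t) \<in> E" for s j t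
    proof -
      have *: "conn (E - ?D) u [i, i] u"
        by (rule conn_ev[OF conn_walk[of _ u "[]"]]) (simp_all add: ev_sq)
      consider "s = v" | "t = v" | "s \<noteq> v" "t \<noteq> v" by blast
      then show ?thesis
      proof cases
        case 1
        with only[of j t] st * nl show ?thesis by (simp add: r_def \<kappa>_def)
      next
        case 2
        with only[of j s] edge_sym[OF st] * nl show ?thesis by (simp add: r_def \<kappa>_def)
      next
        case 3
        with st have "walk (E - ?D) s [j] t" by simp
        with 3 show ?thesis by (simp add: r_def \<kappa>_def conn_walk)
      qed
    qed
    show "\<exists>x\<in>V. \<exists>w. walk (E - ?D) (r x) w v'" if "v' \<in> V - {v}" for v'
    proof -
      have "walk (E - ?D) (r v') [] v'" using that by (simp add: r_def)
      with that show ?thesis by blast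
    qed
  qed
  from minimal[OF this] cE show False by linarith
qed

text \<open>The sum of degree minus two over all vertices is at most \<open>2 * k - 2\<close>.
  Negative terms occur at \<open>a\<close> and \<open>b\<close> only; crediting each of these one
  unit makes all terms nonnegative and those in \<open>U\<close> positive.\<close>

lemma special_bound:
  assumes U: "U \<subseteq> V" "\<And>v. v \<in> U \<Longrightarrow> 2 \<le> card (outs v) \<and> (v = a \<or> v = b \<or> 3 \<le> card (outs v))"
  shows "card U \<le> 2 * k"
proof -
  have out1: "1 \<le> card (outs v)" if "v \<in> V" for v
    using ex_out[OF that] finite_outs[of v]
    by (auto simp: Suc_le_eq card_gt_0_iff outs_def)
  have "(\<Sum>v\<in>V. 2 + of_bool (v \<in> U)) \<le>
      (\<Sum>v\<in>V. card (outs v) + of_bool (v = a) + of_bool (v = b))"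
  proof (rule sum_mono)
    fix v assume v: "v \<in> V"
    show "2 + of_bool (v \<in> U) \<le> card (outs v) + of_bool (v = a) + of_bool (v = b)"
      using U(2)[of v] not_leaf[OF v] out1[OF v] by (cases "v \<in> U"; cases "v = a"; cases "v = b") auto
  qed
  moreover have "(\<Sum>v\<in>V. 2 + of_bool (v \<in> U)) = 2 * card V + card U"
  proof -
    have "(\<Sum>v\<in>V. of_bool (v \<in> U) :: nat) = card (V \<inter> {v. v \<in> U})"
      using fin_V by (simp only: of_bool_def sum.If_cases) simp
    also have "V \<inter> {v. v \<in> U} = U" using U(1) by blast
    finally show ?thesis by (simp only: sum.distrib) simp
  qed
  moreover have "(\<Sum>v\<in>V. card (outs v) + of_bool (v = a) + of_bool (v = b)) = card E + 2"
    using a_V b_V fin_V by (simp add: sum.distrib sum_card_outs of_bool_def sum.If_cases)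
  ultimately show ?thesis using validD(7)[OF val] by linarith
qed


text \<open>A path alternating between \<open>i\<close> and \<open>j\<close> that misses only three edges of the relator
  cycle passes through at most \<open>2 * k\<close> special vertices, so it contains three consecutive
  vertices of degree two off \<open>{a, b}\<close>. Deleting these and closing up the relator cycle by three
  edges yields a smaller graph.\<close>

lemma no_long_alternating_path:
  assumes ij: "i \<in> I" "j \<in> I" "i \<noteq> j" and p: "3 * k + 7 \<le> p"
    and rel: "ev (concat (replicate p [i, j])) = ev []"
    and inj: "inj_on x {..2 * p - 3}"
    and path: "\<And>t. t < 2 * p - 3 \<Longrightarrow> (x t, if even t then i else j, x (Suc t)) \<in> E"
  shows False
proof -
  define N where "N = 2 * p - 3"
  have N: "6 * k + 11 \<le> N" "odd N" "N + 3 = 2 * p" using p unfolding N_def by auto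
  define y where "y t = (if even t then i else j)" for t :: nat
  have yI: "y t \<in> I" and y_Suc: "y (Suc t) \<noteq> y t" for t using ij unfolding y_def by auto
  have path': "(x t, y t, x (Suc t)) \<in> E" if "t < N" for t
    using path that unfolding y_def N_def by simp
  have xeq: "x t = x t' \<longleftrightarrow> t = t'" if "t \<le> N" "t' \<le> N" for t t'
    using inj_onD[OF inj] that unfolding N_def by auto
  have xV: "x t \<in> V" if "t \<le> N" for t
  proof (cases t)
    case 0
    then show ?thesis using edge_V(1)[OF path'[of 0]] N by simp
  next
    case (Suc s)
    then show ?thesis using edge_V(2)[OF path'[of s]] that by simp
  qed
  have relw: "ev (map y [0..<2 * p]) = ev []"
    using rel unfolding y_def map_alternating_upt .
  let ?O = "\<lambda>t. {(x (Suc t), y (Suc t), x (Suc (Suc t))), (x (Suc t), y t, x t)}"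
  have two: "?O t \<subseteq> outs (x (Suc t))" "card (?O t) = 2" if "Suc t < N" for t
    using path'[of t] path'[of "Suc t"] that edge_sym y_Suc[of t] unfolding outs_def by auto
  have two': "2 \<le> card (outs (x (Suc t)))" if "Suc t < N" for t
    using card_mono[OF finite_outs two(1)[OF that]] two(2)[OF that] by simp
  \<comment> \<open>Otherwise each of the \<open>2 * k + 1\<close> disjoint blocks of positions
    \<open>3 * q + 1\<close> to \<open>3 * q + 3\<close> contains a special vertex, one more than
    \<open>special_bound\<close> permits.\<close>
  have "\<exists>d. d + 4 \<le> N \<and> (\<forall>c\<in>{1,2,3}. x (d + c) \<noteq> a \<and> x (d + c) \<noteq> b \<and> card (outs (x (d + c))) \<le> 2)"
  proof (rule ccontr)
    assume no: "\<not> ?thesis"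
    have "\<exists>c\<in>{1,2,3}. x (3 * q + c) = a \<or> x (3 * q + c) = b \<or> 3 \<le> card (outs (x (3 * q + c)))"
      if "q \<le> 2 * k" for q
      using no that N(1) by (auto simp: not_le not_less Suc_le_eq eval_nat_numeral dest!: spec[of _ "3 * q"])
    then obtain cc where cc: "\<And>q. q \<le> 2 * k \<Longrightarrow> cc q \<in> {1,2,3} \<and>
        (x (3 * q + cc q) = a \<or> x (3 * q + cc q) = b \<or> 3 \<le> card (outs (x (3 * q + cc q))))"
      by metis
    have cc13: "1 \<le> cc q" "cc q \<le> 3" if "q \<le> 2 * k" for q using cc[OF that] by auto
    let ?h = "\<lambda>q. x (3 * q + cc q)"
    have le: "3 * q + cc q < N" if "q \<le> 2 * k" for q using cc13[OF that] that N(1) by linarith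
    have "inj_on ?h {..2 * k}"
    proof (rule inj_onI)
      fix q q' assume q: "q \<in> {..2 * k}" "q' \<in> {..2 * k}" "?h q = ?h q'"
      then have "3 * q + cc q = 3 * q' + cc q'" using xeq le by (simp add: less_imp_le)
      with q cc13[of q] cc13[of q'] show "q = q'" by simp
    qed
    then have "card (?h ` {..2 * k}) = 2 * k + 1" by (simp add: card_image)
    moreover have "card (?h ` {..2 * k}) \<le> 2 * k"
    proof (rule special_bound)
      show "?h ` {..2 * k} \<subseteq> V" by (intro image_subsetI xV less_imp_le[OF le]) simp
      fix v assume "v \<in> ?h ` {..2 * k}"
      then obtain q where q: "q \<le> 2 * k" "v = ?h q" by auto
      have "3 * q + cc q = Suc (3 * q + cc q - 1)" using cc13[OF q(1)] by simp
      then have "2 \<le> card (outs v)" using two'[of "3 * q + cc q - 1"] le[OF q(1)] q(2) by simp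
      then show "2 \<le> card (outs v) \<and> (v = a \<or> v = b \<or> 3 \<le> card (outs v))"
        using cc[OF q(1)] q(2) by blast
    qed
    ultimately show False by simp
  qed
  then obtain d where d: "d + 4 \<le> N"
    and ns: "\<And>c. c \<in> {1,2,3} \<Longrightarrow> x (d + c) \<noteq> a \<and> x (d + c) \<noteq> b \<and> card (outs (x (d + c))) \<le> 2"
    by blast
  define D where "D = x ` {d + 1..d + 3}"
  have c13: "t - d \<in> {1, 2, 3} \<and> d + (t - d) = t" if "t \<in> {d + 1..d + 3}" for t
    using that by auto
  have abD: "a \<notin> D" "b \<notin> D"
  proof -
    have "x t \<noteq> a \<and> x t \<noteq> b" if "t \<in> {d + 1..d + 3}" for t
      using ns[of "t - d"] c13[OF that] by simp
    then show "a \<notin> D" "b \<notin> D" unfolding D_def by blast+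
  qed
  have xD: "x t \<in> D \<longleftrightarrow> t \<in> {d + 1..d + 3}" if "t \<le> N" for t
    using that d xeq unfolding D_def by (auto simp: image_iff)
  have outsD: "outs (x (Suc t)) = ?O t" if t: "Suc t \<in> {d + 1..d + 3}" for t
  proof (rule card_seteq[symmetric, OF finite_outs])
    have "Suc t < N" using t d by simp
    note * = two[OF this]
    show "?O t \<subseteq> outs (x (Suc t))" by (rule *(1))
    show "card (outs (x (Suc t))) \<le> card (?O t)"
      using ns[of "Suc t - d"] c13[OF t] *(2) by simp
  qed
  have arc: "\<exists>t\<in>{d..d + 3}. (u, s, w) = (x t, y t, x (Suc t)) \<or> (u, s, w) = (x (Suc t), y t, x t)"
    if e: "(u, s, w) \<in> E" and uD: "u \<in> D" for u s w
  proof -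
    obtain t where t: "t \<in> {d + 1..d + 3}" "u = x t" using uD unfolding D_def by blast
    then obtain t' where t': "t = Suc t'" by (cases t) auto
    have "(u, s, w) \<in> outs (x (Suc t'))" using e t t' unfolding outs_def by simp
    then have "(u, s, w) \<in> ?O t'" using outsD t t' by simp
    moreover have "t' \<in> {d..d + 3}" "Suc t' \<in> {d..d + 3}" using t t' by auto
    ultimately show ?thesis by blast
  qed
  obtain p1 where p1: "p1 \<notin> V" using ex_new_if_finite[OF infinite_UNIV_nat fin_V] by blast
  obtain p2 where p2: "p2 \<notin> insert p1 V"
    using ex_new_if_finite[OF infinite_UNIV_nat, of "insert p1 V"] fin_V by blast
  \<comment> \<open>The path continued to the whole relator cycle: \<open>p1\<close> and
    \<open>p2\<close> sit at positions \<open>N + 1\<close> and \<open>N + 2\<close>, and position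
    \<open>N + 3 = 2 * p\<close> is \<open>x 0\<close> again.\<close>
  define x' where "x' t = (if t \<le> N then x t else if t = N + 1 then p1 else if t = N + 2 then p2 else x 0)" for t
  define F where "F = (\<lambda>t. (x' t, y t, x' (Suc t))) ` {N..<N + 3}"
  define F' where "F' = (\<lambda>t. (x' (Suc t), y t, x' t)) ` {N..<N + 3}"
  define E1 where "E1 = {(u, s, w) \<in> E. u \<notin> D \<and> w \<notin> D}"
  define E' where "E' = E1 \<union> (F \<union> F')"
  define V' where "V' = (V - D) \<union> {p1, p2}"
  define \<phi>' where "\<phi>' = \<phi>(p1 := act (\<phi> (x N)) (y N), p2 := act (act (\<phi> (x N)) (y N)) (y (Suc N)))"
  have DV: "D \<subseteq> V" "card D = 3" "finite D"
  proof -
    show "D \<subseteq> V" using xV d unfolding D_def by auto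
    have "inj_on x {d + 1..d + 3}" using d xeq by (auto intro!: inj_onI)
    then show "card D = 3" unfolding D_def by (simp add: card_image)
    show "finite D" unfolding D_def by simp
  qed
  have x'V: "x' t \<in> V'" if "t \<le> d \<or> d + 4 \<le> t" for t
  proof -
    have "x 0 \<notin> D" "x 0 \<in> V" using xD[of 0] xV[of 0] by auto
    then show ?thesis using that xD[of t] xV[of t] unfolding x'_def V'_def by auto
  qed
  have \<phi>'V: "\<phi>' v = \<phi> v" if "v \<in> V" for v using that p1 p2 unfolding \<phi>'_def by auto
  have \<phi>'X: "\<phi>' v \<in> X" if "v \<in> V'" for v
    using that X_vertex act_closed xV[of N] unfolding \<phi>'_def V'_def by auto
  \<comment> \<open>The third new edge ends at the old vertex \<open>x 0\<close>; it lies over an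
    edge of the Schreier graph because the relator acts trivially.\<close>
  have F_act: "\<phi>' (x' (Suc t)) = act (\<phi>' (x' t)) (y t)" if "t \<in> {N..<N + 3}" for t
  proof -
    have x0: "x 0 \<in> V" "x N \<in> V" using xV by auto
    have "walk E (x 0) (map y [0..<N]) (x N)" using path' by (intro walk_map_upt) auto
    then have 1: "\<phi> (x N) = foldl act (\<phi> (x 0)) (map y [0..<N])" by (rule lgraph_walk_foldl[OF L])
    have "foldl act (\<phi> (x 0)) (map y [0..<2 * p]) = \<phi> (x 0)"
      using act_ev[OF X_vertex[OF x0(1)] relw] by simp
    moreover have "[0..<2 * p] = [0..<N] @ [N, Suc N, Suc (Suc N)]"
      unfolding N(3)[symmetric] by (simp add: numeral_3_eq_3)
    ultimately have 2: "\<phi> (x 0) = act (act (act (\<phi> (x N)) (y N)) (y (Suc N))) (y (Suc (Suc N)))"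
      using 1 by simp
    from that have "t = N \<or> t = Suc N \<or> t = Suc (Suc N)" by auto
    moreover have "x' N = x N" "x' (Suc N) = p1" "x' (Suc (Suc N)) = p2" "x' (Suc (Suc (Suc N))) = x 0"
      unfolding x'_def by simp_all
    moreover have "\<phi>' (x N) = \<phi> (x N)" "\<phi>' (x 0) = \<phi> (x 0)" "\<phi>' p1 = act (\<phi> (x N)) (y N)"
      "\<phi>' p2 = act (act (\<phi> (x N)) (y N)) (y (Suc N))"
      using \<phi>'V x0 p2 unfolding \<phi>'_def by simp_all
    ultimately show ?thesis using 2 by (elim disjE) (simp_all only:)
  qed
  have x'VN: "x' t \<in> V'" "x' (Suc t) \<in> V'" if "t \<in> {N..<N + 3}" for t
    using x'V that d by auto
  have E'_sym: "(w, s, u) \<in> E'" if "(u, s, w) \<in> E'" for u s w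
  proof -
    have "(u, s, w) \<in> F \<longleftrightarrow> (w, s, u) \<in> F'" "(u, s, w) \<in> F' \<longleftrightarrow> (w, s, u) \<in> F"
      unfolding F_def F'_def image_iff by auto
    moreover have "(w, s, u) \<in> E1" if "(u, s, w) \<in> E1" using that edge_sym unfolding E1_def by simp
    ultimately show ?thesis using that unfolding E'_def by blast
  qed
  have lg: "lgraph V' E' \<phi>'"
  proof -
    have "u \<in> V' \<and> s \<in> I \<and> w \<in> V' \<and> \<phi>' w = act (\<phi>' u) s" if e: "(u, s, w) \<in> E'" for u s w
    proof -
      from e consider "(u, s, w) \<in> E1" | t where "t \<in> {N..<N + 3}" "(u, s, w) = (x' t, y t, x' (Suc t))"
        | t where "t \<in> {N..<N + 3}" "(u, s, w) = (x' (Suc t), y t, x' t)"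
        unfolding E'_def F_def F'_def by blast
      then show ?thesis
      proof cases
        case 1
        then have *: "(u, s, w) \<in> E" "u \<notin> D" "w \<notin> D" unfolding E1_def by auto
        then show ?thesis using edge_V[OF *(1)] edge_I[OF *(1)] edge_act[OF *(1)] \<phi>'V
          unfolding V'_def by auto
      next
        case 2
        then show ?thesis using x'VN F_act yI by auto
      next
        case 3
        then show ?thesis using x'VN F_act yI act_act[OF \<phi>'X] by auto
      qed
    qed
    then show ?thesis unfolding lgraph_def using E'_sym \<phi>'X fin_V V'_def by auto
  qed
  \<comment> \<open>Four edges meet the three deleted vertices, each counted in both
    orientations.\<close>
  have cE1: "card E1 \<le> card E - 8" "8 \<le> card E"
  proof -
    let ?R = "(\<lambda>t. (x t, y t, x (Suc t))) ` {d..<d + 4}"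
    let ?R' = "(\<lambda>t. (x (Suc t), y t, x t)) ` {d..<d + 4}"
    have "card ?R = 4" "card ?R' = 4"
      using d xeq by (auto simp: card_image inj_on_def)
    moreover have "?R \<inter> ?R' = {}"
    proof -
      have False if t: "t \<in> {d..<d + 4}" "t' \<in> {d..<d + 4}" "x t = x (Suc t')" "x (Suc t) = x t'" for t t'
      proof -
        have "t = Suc t'" "Suc t = t'" using t d xeq by auto
        then show False by simp
      qed
      then show ?thesis by (fastforce)
    qed
    ultimately have c8: "card (?R \<union> ?R') = 8" by (subst card_Un_disjoint) auto
    have RE: "?R \<union> ?R' \<subseteq> E" using path' d edge_sym by auto
    have inD: "x t \<in> D \<or> x (Suc t) \<in> D" if "t \<in> {d..<d + 4}" for t
      using that d xD[of t] xD[of "Suc t"] by auto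
    then have "E1 \<subseteq> E - (?R \<union> ?R')" unfolding E1_def by blast
    then have "card E1 \<le> card (E - (?R \<union> ?R'))" by (intro card_mono) (use fin_E in auto)
    also have "\<dots> = card E - 8" using RE c8 by (subst card_Diff_subset) auto
    finally show "card E1 \<le> card E - 8" .
    show "8 \<le> card E" using card_mono[OF fin_E RE] c8 by simp
  qed
  \<comment> \<open>Three new edges, again in both orientations. In all, two triples and one vertex
    disappear, which preserves the Betti number.\<close>
  have "card (F \<union> F') \<le> card F + card F'" by (rule card_Un_le)
  also have "\<dots> \<le> card {N..<N + 3} + card {N..<N + 3}"
    unfolding F_def F'_def by (intro add_mono card_image_le) auto
  finally have cF: "card (F \<union> F') \<le> 6" by simp
  have "card E' \<le> card E1 + card (F \<union> F')" unfolding E'_def by (rule card_Un_le)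
  with cF cE1 have cE': "card E' + 2 \<le> card E" by linarith
  have cV': "card V' = card V - 3 + 2" "3 \<le> card V"
  proof -
    have "card V' = card (V - D) + card {p1, p2}"
      unfolding V'_def using p1 p2 fin_V by (intro card_Un_disjoint) auto
    then show "card V' = card V - 3 + 2" using DV p2 by (simp add: card_Diff_subset)
    show "3 \<le> card V" using card_mono[OF fin_V DV(1)] DV(2) by simp
  qed
  \<comment> \<open>The deleted vertices retract along the arc to its start \<open>x d\<close>. All
    edges of the arc but the last become trivial, and the last becomes the whole arc from
    \<open>x d\<close> to \<open>x (d + 4)\<close>.\<close>
  define r where "r v = (if v \<in> D then x d else v)" for v
  define \<kappa> where "\<kappa> v = (if v \<in> D then rev (map y [d..<inv_into {..N} x v]) else [])" for v
  have injN: "inj_on x {..N}" using inj unfolding N_def .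
  have r_arc: "r (x t) = x d" "\<kappa> (x t) = rev (map y [d..<t])" if t: "t \<in> {d..d + 3}" for t
  proof -
    have tN: "t \<le> N" using t d by simp
    have inv: "inv_into {..N} x (x t) = t" using inv_into_f_f[OF injN] tN by simp
    show "r (x t) = x d" "\<kappa> (x t) = rev (map y [d..<t])"
      using xD[OF tN] t inv unfolding r_def \<kappa>_def by (cases "t = d"; auto)+
  qed
  have off_arc: "r (x (d + 4)) = x (d + 4)" "\<kappa> (x (d + 4)) = []"
    using xD[OF d] unfolding r_def \<kappa>_def by auto
  \<comment> \<open>The complement of the arc in the relator cycle, read backwards, has the same
    value as the arc.\<close>
  have around: "conn E' (x d) (map y [d..<d + 4]) (x (d + 4))"
  proof -
    let ?A = "map y [0..<d]" and ?B = "map y [d..<d + 4]" and ?C = "map y [d + 4..<2 * p]"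
    have E'x: "(x' t, y t, x' (Suc t)) \<in> E'" if t: "t < d \<or> d + 4 \<le> t" "t < N + 3" for t
    proof (cases "t < N")
      case True
      then have "x t \<notin> D" "x (Suc t) \<notin> D" using t xD[of t] xD[of "Suc t"] by auto
      then show ?thesis using True path'[of t] unfolding E'_def E1_def x'_def by simp
    next
      case False
      then have "t \<in> {N..<N + 3}" using t by simp
      then show ?thesis unfolding E'_def F_def by blast
    qed
    have "walk E' (x' (d + 4)) ?C (x' (2 * p))"
      using E'x d N by (intro walk_map_upt) auto
    moreover have "x' (2 * p) = x' 0" unfolding N(3)[symmetric] x'_def by simp
    moreover have "walk E' (x' 0) ?A (x' d)"
      using E'x d by (intro walk_map_upt) auto
    ultimately have "walk E' (x' (d + 4)) (?C @ ?A) (x' d)" using walk_append by metis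
    then have w: "walk E' (x' d) (rev (?C @ ?A)) (x' (d + 4))" by (rule walk_rev[rotated]) (rule E'_sym)
    have split: "map y [0..<2 * p] = ?A @ ?B @ ?C"
    proof -
      have "[0..<2 * p] = [0..<d + 4] @ [d + 4..<2 * p]"
        using d N upt_add_eq_append[of 0 "d + 4" "2 * p - (d + 4)"] by simp
      moreover have "[0..<d + 4] = [0..<d] @ [d..<d + 4]" using upt_add_eq_append[of 0 d 4] by simp
      ultimately show ?thesis by simp
    qed
    have "ev (rev (?C @ ?A)) = ev (rev ?A @ [] @ rev ?C)" by simp
    also have "\<dots> = ev (rev ?A @ (?A @ ?B @ ?C) @ rev ?C)"
      using relw split by (intro ev_cong3) simp
    also have "\<dots> = ev ((rev ?A @ ?A) @ ?B @ (?C @ rev ?C))" by simp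
    also have "\<dots> = ev ([] @ ?B @ [])" by (intro ev_append ev_rev_left ev_rev_right HOL.refl)
    finally have "ev (rev (?C @ ?A)) = ev ?B" by simp
    then show ?thesis using w d conn_ev[OF conn_walk] unfolding x'_def by simp
  qed
  have forward: "conn E' (r (x t)) (rev (\<kappa> (x t)) @ [y t] @ \<kappa> (x (Suc t))) (r (x (Suc t)))"
    if t: "t \<in> {d..d + 3}" for t
  proof (cases "t = d + 3")
    case True
    have "map y [d..<d + 3] @ [y (d + 3)] = map y [d..<d + 4]" by (simp add: eval_nat_numeral)
    then show ?thesis using around r_arc[OF t] off_arc True by (simp add: eval_nat_numeral)
  next
    case False
    then have t': "Suc t \<in> {d..d + 3}" using t by simp
    have "map y [d..<Suc t] = map y [d..<t] @ [y t]" using t by simp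
    then have "rev (\<kappa> (x t)) @ [y t] @ \<kappa> (x (Suc t)) = map y [d..<Suc t] @ rev (map y [d..<Suc t])"
      using r_arc(2)[OF t] r_arc(2)[OF t'] by simp
    moreover have "conn E' (x d) (map y [d..<Suc t] @ rev (map y [d..<Suc t])) (x d)"
      by (rule conn_ev[OF conn_walk[of _ "x d" "[]"]]) (simp_all only: ev_rev_right walk.simps)
    ultimately show ?thesis using r_arc(1)[OF t] r_arc(1)[OF t'] by simp
  qed
  have "valid k T g c V' E' \<phi>' (r a) (r b)"
  proof (rule valid_transfer[OF val lg, where \<kappa> = \<kappa>])
    show "card E' + 2 \<le> 2 * card V' + 2 * k"
      using cE' cV' validD(7)[OF val] by linarith
    have "x d \<in> V" "x d \<notin> D" using xV[of d] xD[of d] d by auto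
    then show "r ` V \<subseteq> V'" unfolding r_def V'_def by auto
    show "\<phi>' (r a) = \<phi> a" "\<kappa> a = []" "\<kappa> b = []"
      using abD \<phi>'V a_V unfolding r_def \<kappa>_def by auto
    show "conn E' (r u) (rev (\<kappa> u) @ [s] @ \<kappa> w) (r w)" if e: "(u, s, w) \<in> E" for u s w
    proof (cases "u \<in> D \<or> w \<in> D")
      case True
      then obtain t where t: "t \<in> {d..d + 3}"
        "(u, s, w) = (x t, y t, x (Suc t)) \<or> (u, s, w) = (x (Suc t), y t, x t)"
        using arc[OF e] arc[OF edge_sym[OF e]] by blast
      then show ?thesis
        using forward[OF t(1)] conn_rev[OF E'_sym forward[OF t(1)]] by auto
    next
      case False
      then have "walk E' u [s] w" using e unfolding E'_def E1_def by simp
      then show ?thesis using False conn_walk unfolding r_def \<kappa>_def by simp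
    qed
    show "\<exists>v\<in>V. \<exists>w. walk E' (r v) w v'" if v': "v' \<in> V'" for v'
    proof -
      have rN: "r (x N) = x N" using xD[of N] d unfolding r_def by simp
      have "(x' N, y N, x' (Suc N)) \<in> E'" "(x' (Suc N), y (Suc N), x' (Suc (Suc N))) \<in> E'"
        unfolding E'_def F_def by auto
      then have "(x N, y N, p1) \<in> E'" "(p1, y (Suc N), p2) \<in> E'" unfolding x'_def by auto
      then have "walk E' (r (x N)) [y N] p1" "walk E' (r (x N)) [y N, y (Suc N)] p2"
        using rN by auto
      moreover have "walk E' (r v') [] v'" "v' \<in> V" if "v' \<in> V - D" using that unfolding r_def by auto
      ultimately show ?thesis using v' xV[of N] unfolding V'_def by blast
    qed
  qed
  from minimal[OF this] cE' show False by simp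
qed

end

section \<open>Completing a partial action\<close>

text \<open>A triple \<open>(x, y, z)\<close> stands for the alternating path that leaves \<open>x\<close>, where the label
  \<open>y\<close> is missing, through the label \<open>z\<close>.\<close>

type_synonym dart = "nat \<times> nat \<times> nat"

text \<open>An exponent \<open>m i j = 0\<close> encodes the absence of a relation between \<open>i\<close> and \<open>j\<close>.\<close>

locale partial_action =
  fixes I V :: "nat set" and E :: "(nat \<times> nat \<times> nat) set" and m :: "nat \<Rightarrow> nat \<Rightarrow> nat"
  assumes fin: "finite I" "finite V"
    and E_sub: "E \<subseteq> V \<times> I \<times> V"
    and E_sym: "(u, i, w) \<in> E \<Longrightarrow> (w, i, u) \<in> E"
    and E_folded: "\<lbrakk>(u, i, w) \<in> E; (u, i, w') \<in> E\<rbrakk> \<Longrightarrow> w = w'"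
    and E_no_loop: "(u, i, u) \<notin> E"
    and m_sym: "m i j = m j i"
    and m_even: "\<lbrakk>i \<in> I; j \<in> I; i \<noteq> j\<rbrakk> \<Longrightarrow> even (m i j)"
    and m_ge: "\<lbrakk>i \<in> I; j \<in> I; i \<noteq> j; 0 < m i j\<rbrakk> \<Longrightarrow> 2 \<le> m i j"
    and m_triangle: "\<lbrakk>i \<in> I; j \<in> I; l \<in> I; i \<noteq> j; i \<noteq> l; j \<noteq> l; 0 < m i j; 0 < m i l; 0 < m j l\<rbrakk>
      \<Longrightarrow> 3 dvd m i j"
    and no_long: "\<lbrakk>i \<in> I; j \<in> I; i \<noteq> j; 0 < m i j; inj_on f {..2 * m i j - 3};
      \<And>t. t < 2 * m i j - 3 \<Longrightarrow> (f t, if even t then i else j, f (Suc t)) \<in> E\<rbrakk> \<Longrightarrow> False"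
    and closed_walk: "\<lbrakk>i \<in> I; j \<in> I; i \<noteq> j; 0 < m i j; C \<subseteq> V;
      \<And>x y. x \<in> C \<Longrightarrow> y \<in> {i, j} \<Longrightarrow> \<exists>x'\<in>C. (x, y, x') \<in> E; x \<in> C\<rbrakk>
      \<Longrightarrow> walk E x (concat (replicate (m i j) [i, j])) x"
begin

definition has :: "nat \<Rightarrow> nat \<Rightarrow> bool" where
  "has s x \<longleftrightarrow> (\<exists>x'. (x, s, x') \<in> E)"

definition nb :: "nat \<Rightarrow> nat \<Rightarrow> nat" where
  "nb s x = (THE x'. (x, s, x') \<in> E)"

lemma nb_eq: "(x, s, x') \<in> E \<Longrightarrow> nb s x = x'"
  unfolding nb_def using E_folded by blast

lemma has_nb: "has s x \<Longrightarrow> (x, s, nb s x) \<in> E"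
  unfolding has_def using nb_eq by auto

lemma hasI: "(x, s, x') \<in> E \<Longrightarrow> has s x"
  unfolding has_def by blast

lemma E_V: "(u, i, w) \<in> E \<Longrightarrow> u \<in> V \<and> i \<in> I \<and> w \<in> V"
  using E_sub by blast

definition component :: "nat set \<Rightarrow> nat \<Rightarrow> nat set" where
  "component K x = {x'. \<exists>w\<in>lists K. walk E x w x'}"

lemma comp_refl: "x \<in> component K x"
  unfolding component_def by (auto intro: bexI[of _ "[]"])

lemma comp_sym: "z \<in> component K x \<Longrightarrow> x \<in> component K z"
  unfolding component_def using walk_rev[of E] E_sym by (auto intro!: bexI[where x = "rev _"])

lemma comp_trans: "z \<in> component K y \<Longrightarrow> y \<in> component K x \<Longrightarrow> z \<in> component K x"
proof -
  assume "z \<in> component K y" "y \<in> component K x"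
  then obtain w w' where "w \<in> lists K" "walk E y w z" "w' \<in> lists K" "walk E x w' y"
    unfolding component_def by blast
  then have "w' @ w \<in> lists K" "walk E x (w' @ w) z" using walk_append by auto
  then show "z \<in> component K x" unfolding component_def by blast
qed

lemma comp_eq: "z \<in> component K x \<Longrightarrow> component K z = component K x"
  by (intro equalityI subsetI; erule comp_trans; simp add: comp_sym)

lemma comp_edge: "(x, s, x') \<in> E \<Longrightarrow> s \<in> K \<Longrightarrow> x' \<in> component K x"
  unfolding component_def by (auto intro!: bexI[of _ "[s]"])

lemma comp_V: "x \<in> V \<Longrightarrow> component K x \<subseteq> V"
proof -
  have "walk E x w z \<Longrightarrow> x \<in> V \<Longrightarrow> z \<in> V" for w x z
    by (induction w arbitrary: x) (use E_V in auto)
  then show "x \<in> V \<Longrightarrow> component K x \<subseteq> V" unfolding component_def by blast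
qed

lemma comp_minimal:
  assumes "x \<in> C" "\<And>u s w. u \<in> C \<Longrightarrow> s \<in> K \<Longrightarrow> (u, s, w) \<in> E \<Longrightarrow> w \<in> C"
  shows "component K x \<subseteq> C"
proof -
  have "walk E u w z \<Longrightarrow> u \<in> C \<Longrightarrow> set w \<subseteq> K \<Longrightarrow> z \<in> C" for w u z
    by (induction w arbitrary: u) (use assms(2) in auto)
  with assms(1) show ?thesis unfolding component_def by auto
qed

section \<open>Alternating paths that start at a missing edge\<close>

fun lab :: "dart \<Rightarrow> nat \<Rightarrow> nat" where
  "lab (x, y, z) t = (if even t then z else y)"

fun labs :: "dart \<Rightarrow> nat set" where
  "labs (x, y, z) = {y, z}"

text \<open>Meant for positions up to \<open>len d\<close> only; after that, \<open>nb\<close> is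
  applied where the edge is missing.\<close>

primrec vert :: "dart \<Rightarrow> nat \<Rightarrow> nat" where
  "vert d 0 = fst d"
| "vert d (Suc t) = nb (lab d t) (vert d t)"

fun is_dart :: "dart \<Rightarrow> bool" where
  "is_dart (x, y, z) \<longleftrightarrow> x \<in> V \<and> y \<in> I \<and> z \<in> I \<and> y \<noteq> z \<and> 0 < m y z \<and> \<not> has y x"

fun per :: "dart \<Rightarrow> nat" where
  "per (x, y, z) = 2 * m y z"

definition len :: "dart \<Rightarrow> nat" where
  "len d = (LEAST t. \<not> has (lab d t) (vert d t))"

lemma lab_Suc: "is_dart d \<Longrightarrow> lab d (Suc t) \<noteq> lab d t"
  by (cases d) auto

lemma lab_labs: "lab d t \<in> labs d"
  by (cases d) auto

lemma lab_cases: "s \<in> labs d \<Longrightarrow> s = lab d t \<or> s = lab d (Suc t)"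
  by (cases d) auto

lemma lab_parity: "even (t + t') \<Longrightarrow> lab d t = lab d t'"
  by (cases d) auto

lemma labs_eq: "labs d = {lab d t, lab d (Suc t)}"
  by (cases d) auto

text \<open>If two positions at odd distance coincide, the edge leaving the first and the edge
  entering the second have the same label, so the interval shrinks from both sides down to a loop.
  At even distance the entering edges have the same label, so the coincidence slides back to
  position 0, where that label is missing.\<close>

lemma no_return:
  assumes d: "is_dart d" and n: "\<And>t. t < n \<Longrightarrow> has (lab d t) (vert d t)"
  shows "inj_on (vert d) {..n}"
proof -
  have e: "(vert d t, lab d t, vert d (Suc t)) \<in> E" if "t < n" for t
    using has_nb[OF n[OF that]] by simp
  have odd: False if "vert d s = vert d (s + Suc (2 * q))" "s + Suc (2 * q) \<le> n" for s q
    using that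
  proof (induction q arbitrary: s)
    case 0
    then show ?case using e[of s] E_no_loop by auto
  next
    case (Suc q)
    have "lab d (s + 2 + 2 * q) = lab d s" by (rule lab_parity) simp
    then have "(vert d s, lab d s, vert d (s + 2 + 2 * q)) \<in> E"
      using E_sym[OF e[of "s + 2 + 2 * q"]] Suc.prems by simp
    then have "vert d (Suc s) = vert d (Suc s + Suc (2 * q))"
      using e[of s] Suc.prems E_folded by fastforce
    then show False using Suc.IH[of "Suc s"] Suc.prems by simp
  qed
  have even: False if "vert d s = vert d (s + 2 * Suc q)" "s + 2 * Suc q \<le> n" for s q
    using that
  proof (induction s)
    case 0
    obtain x y z where xyz: "d = (x, y, z)" by (cases d)
    have "(vert d (Suc (2 * q)), y, x) \<in> E" using e[of "Suc (2 * q)"] 0 xyz by simp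
    then show ?case using d xyz E_sym hasI by fastforce
  next
    case (Suc s)
    have "lab d (s + 2 * Suc q) = lab d s" by (rule lab_parity) simp
    then have "(vert d (Suc s), lab d s, vert d (s + 2 * Suc q)) \<in> E"
      using E_sym[OF e[of "s + 2 * Suc q"]] Suc.prems by simp
    moreover have "(vert d (Suc s), lab d s, vert d s) \<in> E" using E_sym[OF e[of s]] Suc.prems by simp
    ultimately have "vert d s = vert d (s + 2 * Suc q)" using E_folded by blast
    then show ?case using Suc by simp
  qed
  have neq: "vert d s \<noteq> vert d t" if "s < t" "t \<le> n" for s t
  proof
    assume eq: "vert d s = vert d t"
    obtain u where u: "t = s + Suc u" using less_imp_Suc_add[OF \<open>s < t\<close>] by auto
    show False
    proof (cases "even u")
      case True
      then obtain q where "u = 2 * q" by (auto elim: evenE)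
      then show False using odd[of s q] eq u that by simp
    next
      case False
      then obtain q where "u = Suc (2 * q)" by (auto elim: oddE)
      then show False using even[of s q] eq u that by simp
    qed
  qed
  show ?thesis
  proof (rule inj_onI)
    fix s t assume "s \<in> {..n}" "t \<in> {..n}" "vert d s = vert d t"
    then show "s = t" using neq[of s t] neq[of t s] by (cases s t rule: linorder_cases) auto
  qed
qed

lemma vert_V:
  assumes "is_dart d" "\<And>t. t < n \<Longrightarrow> has (lab d t) (vert d t)"
  shows "vert d n \<in> V"
proof (cases n)
  case 0
  then show ?thesis using assms(1) by (cases d) auto
next
  case (Suc n')
  then show ?thesis using has_nb[OF assms(2)[of n']] E_V by auto
qed

text \<open>A path without repetition in the finite set \<open>V\<close> must stop. The bound
  \<open>len d + 4 \<le> per d\<close> leaves room on the cycle for the two shared vertices and at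
  least one private vertex.\<close>

lemma len:
  assumes d: "is_dart d"
  shows "\<not> has (lab d (len d)) (vert d (len d))" "t < len d \<Longrightarrow> has (lab d t) (vert d t)"
    "len d + 4 \<le> per d"
proof -
  have "\<exists>t. \<not> has (lab d t) (vert d t)"
  proof (rule ccontr)
    assume no: "\<not> ?thesis"
    have "inj_on (vert d) {..card V}" using no_return[OF d] no by blast
    then have "card (vert d ` {..card V}) = Suc (card V)" by (simp add: card_image)
    moreover have "vert d ` {..card V} \<subseteq> V" using vert_V[OF d] no by blast
    then have "card (vert d ` {..card V}) \<le> card V" by (rule card_mono[OF fin(2)])
    ultimately show False by simp
  qed
  then show 1: "\<not> has (lab d (len d)) (vert d (len d))" unfolding len_def by (rule LeastI_ex)
  show 2: "has (lab d t) (vert d t)" if "t < len d" for t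
    using not_less_Least[of t] that unfolding len_def by blast
  obtain x y z where xyz: "d = (x, y, z)" by (cases d)
  have m2: "2 \<le> m y z" using d xyz m_ge by auto
  show "len d + 4 \<le> per d"
  proof (rule ccontr)
    assume "\<not> ?thesis"
    then have le: "2 * m z y - 3 \<le> len d" using xyz m_sym[of y z] by simp
    have inj: "inj_on (vert d) {..2 * m z y - 3}"
      using le by (intro no_return[OF d] 2) simp
    show False
    proof (rule no_long[OF _ _ _ _ inj])
      show "(vert d t, if even t then z else y, vert d (Suc t)) \<in> E" if "t < 2 * m z y - 3" for t
        using has_nb[OF 2[of t]] that le xyz by simp
    qed (use d xyz m2 m_sym[of y z] in auto)
  qed
qed

lemma vert_edge: "is_dart d \<Longrightarrow> t < len d \<Longrightarrow> (vert d t, lab d t, vert d (Suc t)) \<in> E"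
  using has_nb[OF len(2)] by simp

lemma inj_vert: "is_dart d \<Longrightarrow> inj_on (vert d) {..len d}"
  using no_return len(2) by blast

lemma vert_len_V: "is_dart d \<Longrightarrow> t \<le> len d \<Longrightarrow> vert d t \<in> V"
  using vert_V[of d t] len(2)[of d] by auto

text \<open>The path cannot be left: at an inner vertex both labels lead to neighbours on the path,
  and at an end the label that the path does not use is missing.\<close>

lemma comp_vert:
  assumes d: "is_dart d"
  shows "component (labs d) (fst d) = vert d ` {..len d}"
proof
  show "component (labs d) (fst d) \<subseteq> vert d ` {..len d}"
  proof (rule comp_minimal)
    show "fst d \<in> vert d ` {..len d}" by (rule image_eqI[of _ _ 0]) auto
    fix u s w assume u: "u \<in> vert d ` {..len d}" and s: "s \<in> labs d" and e: "(u, s, w) \<in> E"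
    obtain t where t: "t \<le> len d" "u = vert d t" using u by auto
    from lab_cases[OF s, of t] show "w \<in> vert d ` {..len d}"
    proof
      assume s: "s = lab d t"
      then have "t < len d" using e t len(1)[OF d] hasI by (metis le_neq_implies_less)
      moreover from this have "w = vert d (Suc t)" using vert_edge[OF d] s t e E_folded by blast
      ultimately show ?thesis by (intro image_eqI[of _ _ "Suc t"]) simp_all
    next
      assume s: "s = lab d (Suc t)"
      show ?thesis
      proof (cases t)
        case 0
        then have False using d e t s hasI by (cases d) auto
        then show ?thesis ..
      next
        case (Suc t')
        have "lab d (Suc t) = lab d t'" unfolding Suc by (rule lab_parity) simp
        then have "w = vert d t'" using E_sym[OF vert_edge[OF d, of t']] t s e Suc E_folded by simp
        then show ?thesis using t Suc by auto
      qed
    qed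
  qed
  have "vert d t \<in> component (labs d) (fst d)" if "t \<le> len d" for t
    using that
  proof (induction t)
    case 0
    then show ?case using comp_refl by simp
  next
    case (Suc t)
    then have "vert d (Suc t) \<in> component (labs d) (vert d t)"
      using vert_edge[OF d, of t] comp_edge lab_labs by auto
    then show ?case using Suc comp_trans by auto
  qed
  then show "vert d ` {..len d} \<subseteq> component (labs d) (fst d)" by auto
qed

text \<open>An alternating path can be described from either end. One dart is chosen for its
  component, so that the path is completed to a single cycle.\<close>

definition cd :: "nat set \<Rightarrow> nat \<Rightarrow> dart" where
  "cd K x = (SOME d. is_dart d \<and> labs d = K \<and> fst d \<in> component K x)"

definition canonical :: "dart \<Rightarrow> bool" where
  "canonical d \<longleftrightarrow> is_dart d \<and> cd (labs d) (fst d) = d"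

lemma cd_comp: "z \<in> component K x \<Longrightarrow> cd K z = cd K x"
  using comp_eq unfolding cd_def by simp

lemma cd_vert: "canonical d \<Longrightarrow> t \<le> len d \<Longrightarrow> cd (labs d) (vert d t) = d"
  using cd_comp[of "vert d t" "labs d" "fst d"] comp_vert[of d] unfolding canonical_def by auto

lemma cd_canonical:
  assumes "is_dart d" "labs d = K" "fst d \<in> component K x"
  shows "canonical (cd K x)" "labs (cd K x) = K" "\<exists>t\<le>len (cd K x). x = vert (cd K x) t"
proof -
  have *: "is_dart (cd K x)" "labs (cd K x) = K" "fst (cd K x) \<in> component K x"
    using someI[of "\<lambda>d. is_dart d \<and> labs d = K \<and> fst d \<in> component K x" d] assms
    unfolding cd_def by auto
  then show "canonical (cd K x)" "labs (cd K x) = K"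
    unfolding canonical_def using cd_comp by auto
  have "x \<in> component K (fst (cd K x))" using *(3) comp_sym by blast
  then show "\<exists>t\<le>len (cd K x). x = vert (cd K x) t"
    using comp_vert[OF *(1)] *(2) by auto
qed

end

text \<open>\<open>Dart x l\<close> is the far end of the new \<open>l\<close>-edge at
  \<open>x\<close>; it mentions no second label, being shared by the cycles of all pairs that
  contain \<open>l\<close>. \<open>Ins d t\<close> is the private vertex at position
  \<open>t\<close> of the cycle of \<open>d\<close>.\<close>

datatype point = Old nat | Dart nat nat | Ins "nat \<times> nat \<times> nat" nat

section \<open>The relator cycles and the involutions they define\<close>

context partial_action
begin

text \<open>The relator cycle through an alternating path: the path itself, the two new neighbours of
  its ends (shared by all relator cycles through these ends), and a nonempty segment of new
  vertices of its own. Positions are taken modulo \<open>per d\<close>.\<close>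

definition cyc :: "dart \<Rightarrow> nat \<Rightarrow> point" where
  "cyc d t = (if t \<le> len d then Old (vert d t)
     else if t = len d + 1 then Dart (vert d (len d)) (lab d (len d))
     else if t = per d - 1 then Dart (fst d) (lab d 1)
     else Ins d t)"

text \<open>The edge between positions \<open>t\<close> and \<open>t + 1\<close> has label
  \<open>lab d t\<close>. Adding \<open>per d - 1\<close> is a step back that stays in the natural
  numbers.\<close>

definition flip :: "dart \<Rightarrow> nat \<Rightarrow> nat \<Rightarrow> nat" where
  "flip d s t = (if s = lab d t then (t + 1) mod per d else (t + per d - 1) mod per d)"

text \<open>The far end of a missing edge sits at position \<open>per d - 1\<close> if the edge is
  the one missing at the start of the chosen path, and at \<open>len d + 1\<close> otherwise. The
  label is tested along with the vertex because a path of length 0 has both its ends at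
  \<open>x\<close>. A pair without relation imposes no cycle, so there the point stays
  fixed.\<close>

primrec \<sigma> :: "nat \<Rightarrow> point \<Rightarrow> point" where
  "\<sigma> s (Old x) = (if has s x then Old (nb s x) else Dart x s)"
| "\<sigma> s (Dart x l) = (if s = l then Old x
     else if m s l = 0 then Dart x l
     else let d = cd {s, l} x in
       if x = fst d \<and> l = lab d 1 then Ins d (per d - 2) else Ins d (len d + 2))"
| "\<sigma> s (Ins d t) = (if s \<in> labs d then cyc d (flip d s t) else Ins d t)"

definition points :: "point set" where
  "points = Old ` V \<union> {Dart x l | x l. x \<in> V \<and> l \<in> I \<and> \<not> has l x} \<union>
     {Ins d t | d t. canonical d \<and> len d + 2 \<le> t \<and> t + 2 \<le> per d}"

lemma is_dart_per: "is_dart d \<Longrightarrow> even (per d) \<and> 4 \<le> per d"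
  using m_ge[of "fst (snd d)" "snd (snd d)"] by (cases d) auto

lemma lab_missing: "is_dart d \<Longrightarrow> \<not> has (lab d 1) (fst d) \<and> lab d 1 \<in> I"
  by (cases d) auto

lemma labs_I: "is_dart d \<Longrightarrow> labs d \<subseteq> I"
  by (cases d) auto

lemma finite_points: "finite points"
proof -
  have fd: "finite {d. canonical d}"
  proof (rule finite_subset)
    show "{d. canonical d} \<subseteq> V \<times> I \<times> I" unfolding canonical_def by auto
  qed (use fin in auto)
  have "{Ins d t | d t. canonical d \<and> len d + 2 \<le> t \<and> t + 2 \<le> per d} \<subseteq>
      (\<Union>d\<in>{d. canonical d}. Ins d ` {..per d})" by auto
  then have "finite {Ins d t | d t. canonical d \<and> len d + 2 \<le> t \<and> t + 2 \<le> per d}"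
    by (rule finite_subset) (use fd in auto)
  moreover have "{Dart x l | x l. x \<in> V \<and> l \<in> I \<and> \<not> has l x} \<subseteq> (\<lambda>(x, l). Dart x l) ` (V \<times> I)"
    by auto
  then have "finite {Dart x l | x l. x \<in> V \<and> l \<in> I \<and> \<not> has l x}"
    by (rule finite_subset) (use fin in auto)
  ultimately show ?thesis unfolding points_def using fin by auto
qed

lemma cyc_points:
  assumes "canonical d" "t < per d"
  shows "cyc d t \<in> points"
proof -
  have d: "is_dart d" using assms unfolding canonical_def by simp
  have "lab d (len d) \<in> I" using labs_I[OF d] lab_labs by blast
  moreover have "fst d \<in> V" using d by (cases d) auto
  moreover have "t + 2 \<le> per d" if "t \<noteq> per d - 1" using that assms(2) by simp
  moreover have "t + 2 \<le> per d \<Longrightarrow> len d + 2 \<le> t \<Longrightarrow> Ins d t \<in> points"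
    unfolding points_def using assms(1) by blast
  ultimately show ?thesis
    using vert_len_V[OF d] len(1)[OF d] lab_missing[OF d] unfolding cyc_def
    by (simp add: points_def image_iff)
qed

lemma cyc_last: "is_dart d \<Longrightarrow> cyc d (per d - 1) = Dart (fst d) (lab d 1)"
  using len(3)[of d] unfolding cyc_def by auto

lemma \<sigma>_cyc:
  assumes c: "canonical d" and t: "t < per d" and s: "s \<in> labs d"
  shows "\<sigma> s (cyc d t) = cyc d (flip d s t)"
proof -
  have d: "is_dart d" using c unfolding canonical_def by simp
  note L = len[OF d]
  have m0: "m s l \<noteq> 0" if "l \<in> labs d" "l \<noteq> s" for l
    using d s that m_sym by (cases d) auto
  have *: "t \<le> len d \<or> t = len d + 1 \<or> t = per d - 1 \<or> t > len d + 1 \<and> t \<noteq> per d - 1" by linarith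
  have **: "t = 0 \<or> (\<exists>u. t = Suc u)" by (cases t) auto
  consider "t \<le> len d" "s = lab d t" | "t = 0" "s \<noteq> lab d t" | u where "t = Suc u" "t \<le> len d" "s \<noteq> lab d t"
    | "t = len d + 1" "s = lab d t" | "t = len d + 1" "s \<noteq> lab d t"
    | "t = per d - 1" "s = lab d t" | "t = per d - 1" "s \<noteq> lab d t"
    | "t > len d + 1" "t \<noteq> per d - 1"
    using * ** by blast
  then show ?thesis
  proof cases
    case 1
    then have fl: "flip d s t = Suc t" using L(3) unfolding flip_def by simp
    show ?thesis
    proof (cases "t = len d")
      case True
      then show ?thesis using 1 L(1) fl unfolding cyc_def by simp
    next
      case False
      then have "has s (vert d t)" using 1 L(2)[of t] by simp
      then show ?thesis using 1 False fl unfolding cyc_def by simp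
    qed
  next
    case 2
    then have "s = lab d 1" using lab_cases[OF s, of 0] by simp
    then show ?thesis using 2 L(3) lab_missing[OF d] t unfolding cyc_def flip_def by auto
  next
    case (3 u)
    have "s = lab d (Suc t)" using lab_cases[OF s, of t] 3 by simp
    then have s': "s = lab d u" using 3 lab_parity[of "Suc t" u d] by simp
    have "(vert d t, s, vert d u) \<in> E" using E_sym[OF vert_edge[OF d, of u]] s' 3 by simp
    moreover have "flip d s t = u" using 3 t unfolding flip_def by simp
    ultimately show ?thesis using 3 nb_eq hasI unfolding cyc_def by simp
  next
    case 4
    have ne: "lab d (len d) \<noteq> s" using 4 lab_Suc[OF d, of "len d"] by simp
    have K: "{s, lab d (len d)} = labs d" using labs_eq[of d "len d"] 4 by auto
    \<comment> \<open>Only a path of length 0 has both ends at one vertex, and then the two missing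
      labels differ.\<close>
    have "\<not> (vert d (len d) = fst d \<and> lab d (len d) = lab d 1)"
    proof
      assume *: "vert d (len d) = fst d \<and> lab d (len d) = lab d 1"
      then have "len d = 0" using inj_onD[OF inj_vert[OF d], of "len d" 0] by simp
      then show False using * lab_Suc[OF d, of 0] by simp
    qed
    then have "\<sigma> s (cyc d t) = Ins d (len d + 2)"
      using 4 ne m0[OF lab_labs ne] cd_vert[OF c, of "len d"] K unfolding cyc_def by auto
    moreover have "flip d s t = len d + 2" using 4 L(3) unfolding flip_def by simp
    ultimately show ?thesis using L(3) unfolding cyc_def by simp
  next
    case 5
    then have "s = lab d (len d + 2)" using lab_cases[OF s, of t] by simp
    then have "s = lab d (len d)" using lab_parity[of "len d + 2" "len d" d] by simp
    then show ?thesis using 5 t unfolding cyc_def flip_def by simp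
  next
    case 6
    have "lab d t = lab d 1" using 6 is_dart_per[OF d] by (intro lab_parity) auto
    moreover have "flip d s t = 0" using 6 L(3) unfolding flip_def by simp
    ultimately show ?thesis using 6 cyc_last[OF d] by (simp add: cyc_def[of d 0])
  next
    case 7
    have l: "lab d t = lab d 1" using 7 is_dart_per[OF d] by (intro lab_parity) auto
    then have ne: "lab d 1 \<noteq> s" using 7 by simp
    have K: "{s, lab d 1} = labs d" using lab_cases[OF s, of 0] ne labs_eq[of d 0] by auto
    have "\<sigma> s (cyc d t) = Ins d (per d - 2)"
      using 7(1) cyc_last[OF d] ne m0[OF lab_labs ne] K c unfolding canonical_def by simp
    moreover have "flip d s t = per d - 2"
    proof -
      have "t + per d - 1 = (per d - 2) + per d" using 7 L(3) by simp
      then have "flip d s t = ((per d - 2) + per d) mod per d" using 7 unfolding flip_def by (simp only: if_False)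
      also have "\<dots> = per d - 2" by (subst mod_add_self2, rule mod_less) (use L(3) in simp)
      finally show ?thesis .
    qed
    moreover have "cyc d (per d - 2) = Ins d (per d - 2)" using L(3) unfolding cyc_def by auto
    ultimately show ?thesis by simp
  next
    case 8
    then have "cyc d t = Ins d t" unfolding cyc_def by simp
    then show ?thesis using s by simp
  qed
qed

lemma flip_less: "0 < per d \<Longrightarrow> flip d s t < per d"
  unfolding flip_def by simp

text \<open>The alternation of labels closes up across position 0 because \<open>per d\<close> is
  even.\<close>

lemma flip_flip:
  assumes d: "is_dart d" and t: "t < per d" and s: "s \<in> labs d"
  shows "flip d s (flip d s t) = t"
proof (cases "s = lab d t")
  case True
  have p: "even (per d)" "4 \<le> per d" using is_dart_per[OF d] by auto
  show ?thesis
  proof (cases "t = per d - 1")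
    case True': True
    then have "lab d 0 \<noteq> lab d t" using lab_Suc[OF d, of 0] lab_parity[of t 1 d] p by simp
    then show ?thesis using True True' p unfolding flip_def by simp
  next
    case False
    then show ?thesis using True t lab_Suc[OF d, of t] unfolding flip_def by simp
  qed
next
  case False
  then have s': "s = lab d (Suc t)" using lab_cases[OF s, of t] by simp
  have p: "even (per d)" "4 \<le> per d" using is_dart_per[OF d] by auto
  show ?thesis
  proof (cases t)
    case 0
    then have "s = lab d (per d - 1)" using s' lab_parity[of "per d - 1" "Suc t" d] p by simp
    then show ?thesis using False 0 p unfolding flip_def by simp
  next
    case (Suc u)
    then have "s = lab d u" using s' lab_parity[of "Suc t" u d] by simp
    then show ?thesis using False Suc t unfolding flip_def by simp
  qed
qed

text \<open>A vertex that lacks one of the two labels is an end of its alternating path, so the far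
  end of the missing edge is one of the two shared vertices on the cycle of that path.\<close>

lemma dart_on_cyc:
  assumes x: "x \<in> V" "\<not> has l x" and l: "l \<in> I" "s \<in> I" "s \<noteq> l" "0 < m s l"
  shows "\<exists>d t. canonical d \<and> labs d = {s, l} \<and> t < per d \<and> Dart x l = cyc d t"
proof -
  have "is_dart (x, l, s)" using assms m_sym[of s l] by simp
  then have *: "canonical (cd {s, l} x)" "labs (cd {s, l} x) = {s, l}"
    "\<exists>t\<le>len (cd {s, l} x). x = vert (cd {s, l} x) t"
    using cd_canonical[of "(x, l, s)" "{s, l}" x] comp_refl by auto
  define d where "d = cd {s, l} x"
  obtain t where t: "t \<le> len d" "x = vert d t" using *(3) unfolding d_def by blast
  have c: "canonical d" "labs d = {s, l}" using *(1,2) unfolding d_def by blast+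
  have d: "is_dart d" using c unfolding canonical_def by simp
  have "l = lab d t \<or> l = lab d (Suc t)" using lab_cases[of l d t] c by simp
  then have "Dart x l = cyc d (len d + 1) \<or> Dart x l = cyc d (per d - 1)"
  proof
    assume l: "l = lab d t"
    then have "t = len d" using len(2)[OF d, of t] t x by (metis le_neq_implies_less)
    then show ?thesis using l t unfolding cyc_def by simp
  next
    assume l: "l = lab d (Suc t)"
    have "t = 0"
    proof (rule ccontr)
      assume "t \<noteq> 0"
      then obtain u where u: "t = Suc u" by (cases t) auto
      then have "l = lab d u" using l lab_parity[of "Suc t" u d] by simp
      then show False using E_sym[OF vert_edge[OF d, of u]] u t x hasI by auto
    qed
    then show ?thesis using l t cyc_last[OF d] by simp
  qed
  moreover have "len d + 1 < per d" "per d - 1 < per d" using len(3)[OF d] by auto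
  ultimately show ?thesis using c by blast
qed

lemma Ins_on_cyc:
  assumes "Ins d t \<in> points"
  shows "canonical d" "t < per d" "cyc d t = Ins d t"
  using assms unfolding points_def cyc_def by auto

lemma \<sigma>_on_cyc:
  assumes "canonical d" "t < per d" "s \<in> labs d"
  shows "\<sigma> s (cyc d t) \<in> points" "\<sigma> s (\<sigma> s (cyc d t)) = cyc d t"
proof -
  have d: "is_dart d" using assms unfolding canonical_def by simp
  have f: "flip d s t < per d" using flip_less is_dart_per[OF d] by simp
  show "\<sigma> s (cyc d t) \<in> points" using \<sigma>_cyc[OF assms] cyc_points[OF assms(1) f] by simp
  show "\<sigma> s (\<sigma> s (cyc d t)) = cyc d t"
    using \<sigma>_cyc[OF assms] \<sigma>_cyc[OF assms(1) f assms(3)] flip_flip[OF d assms(2,3)] by simp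
qed

lemma \<sigma>_involution:
  assumes q: "q \<in> points" and s: "s \<in> I"
  shows "\<sigma> s q \<in> points \<and> \<sigma> s (\<sigma> s q) = q"
proof (cases q)
  case (Old x)
  have x: "x \<in> V" using q Old unfolding points_def by auto
  show ?thesis
  proof (cases "has s x")
    case True
    note e = has_nb[OF True]
    have "has s (nb s x)" "nb s (nb s x) = x" using E_sym[OF e] hasI nb_eq by blast+
    then show ?thesis using True Old E_V[OF e] unfolding points_def by simp
  next
    case False
    then show ?thesis using Old x s unfolding points_def by simp
  qed
next
  case (Dart x l)
  have x: "x \<in> V" "\<not> has l x" "l \<in> I" using q Dart unfolding points_def by auto
  consider "s = l" | "s \<noteq> l" "m s l = 0" | "s \<noteq> l" "0 < m s l" by blast
  then show ?thesis
  proof cases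
    case 1
    then show ?thesis using Dart x unfolding points_def by simp
  next
    case 2
    then show ?thesis using Dart q by simp
  next
    case 3
    obtain d t where "canonical d" "labs d = {s, l}" "t < per d" "Dart x l = cyc d t"
      using dart_on_cyc[OF x(1,2,3) s 3] by blast
    then show ?thesis using \<sigma>_on_cyc[of d t s] Dart by simp
  qed
next
  case (Ins d t)
  have c: "canonical d" "t < per d" "cyc d t = Ins d t" using Ins_on_cyc q Ins by auto
  show ?thesis
  proof (cases "s \<in> labs d")
    case True
    then show ?thesis using \<sigma>_on_cyc[OF c(1,2) True] c(3) Ins by simp
  next
    case False
    then show ?thesis using Ins q by simp
  qed
qed

lemmas \<sigma>_points = \<sigma>_involution[THEN conjunct1] and \<sigma>_\<sigma> = \<sigma>_involution[THEN conjunct2]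

section \<open>Orders of the products of two involutions\<close>

definition rot :: "nat \<Rightarrow> nat \<Rightarrow> point \<Rightarrow> point" where
  "rot i j q = \<sigma> j (\<sigma> i q)"

lemma rot_points: "q \<in> points \<Longrightarrow> i \<in> I \<Longrightarrow> j \<in> I \<Longrightarrow> (rot i j ^^ n) q \<in> points"
  by (induction n) (auto simp: rot_def \<sigma>_points)

text \<open>\<open>\<sigma> i\<close> conjugates the rotation to its inverse, as in a dihedral
  group. Hence it suffices to check that a power fixes one point of a pair exchanged by
  \<open>\<sigma> i\<close> or by \<open>\<sigma> j\<close>.\<close>

lemma rot_reflect:
  assumes "q \<in> points" "i \<in> I" "j \<in> I"
  shows "(rot i j ^^ n) (\<sigma> i ((rot i j ^^ n) q)) = \<sigma> i q"
proof (induction n)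
  case (Suc n)
  let ?q = "(rot i j ^^ n) q"
  have q: "?q \<in> points" using rot_points assms by blast
  have "(rot i j ^^ Suc n) (\<sigma> i ((rot i j ^^ Suc n) q)) = (rot i j ^^ n) (rot i j (\<sigma> i (rot i j ?q)))"
    by (simp add: funpow_swap1)
  also have "rot i j (\<sigma> i (rot i j ?q)) = \<sigma> i ?q"
    using q assms by (simp add: rot_def \<sigma>_points \<sigma>_\<sigma>)
  finally show ?case using Suc by simp
qed simp

lemma rot_fix_first:
  assumes "q \<in> points" "i \<in> I" "j \<in> I" "(rot i j ^^ n) q = q"
  shows "(rot i j ^^ n) (\<sigma> i q) = \<sigma> i q"
  using rot_reflect[OF assms(1-3), of n] assms(4) by simp

lemma rot_fix_first_iff:
  assumes "q \<in> points" "i \<in> I" "j \<in> I" "(rot i j ^^ n) (\<sigma> i q) = \<sigma> i q"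
  shows "(rot i j ^^ n) q = q"
  using rot_fix_first[OF _ assms(2,3,4)] assms(1,2) by (simp add: \<sigma>_points \<sigma>_\<sigma>)

lemma rot_fix_second_iff:
  assumes "q \<in> points" "i \<in> I" "j \<in> I" "(rot i j ^^ n) (\<sigma> j q) = \<sigma> j q"
  shows "(rot i j ^^ n) q = q"
proof -
  have p: "\<sigma> j q \<in> points" using assms \<sigma>_points by blast
  have "(rot i j ^^ n) (rot i j (\<sigma> i (\<sigma> j q))) = rot i j (\<sigma> i (\<sigma> j q))"
    using rot_fix_first[OF p assms(2-4)] by (simp add: funpow_swap1[symmetric])
  moreover have "rot i j (\<sigma> i (\<sigma> j q)) = q" using assms by (simp add: rot_def \<sigma>_points \<sigma>_\<sigma>)
  ultimately show ?thesis by simp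
qed

lemma funpow_dvd_fix:
  assumes "(f ^^ a) q = q" "a dvd n"
  shows "(f ^^ n) q = q"
proof -
  obtain b where n: "n = b * a" using assms(2) by (auto simp: dvd_def mult.commute)
  have "(f ^^ (b * a)) q = q" by (induction b) (simp_all add: funpow_add assms(1))
  then show ?thesis using n by simp
qed

text \<open>A rotation moves a position by two steps, so \<open>m i j\<close> of them make one full
  turn of length \<open>per d = 2 * m i j\<close>. Only positions from which \<open>i\<close> leads
  forward are computed; \<open>\<sigma> i\<close> carries the others to such positions.\<close>

lemma rot_cyc:
  assumes c: "canonical d" and t: "t < per d" and ij: "labs d = {i, j}" "i \<noteq> j" "i \<in> I" "j \<in> I"
  shows "(rot i j ^^ m i j) (cyc d t) = cyc d t"
proof -
  have d: "is_dart d" using c unfolding canonical_def by simp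
  have per: "per d = 2 * m i j"
    using d ij by (cases d) (auto simp: doubleton_eq_iff m_sym[of i j])
  have p: "even (per d)" "4 \<le> per d" using is_dart_per[OF d] by auto
  have lt: "u mod per d < per d" for u using p by simp
  have lab_mod: "lab d (u mod per d) = lab d u" for u
  proof (rule lab_parity)
    have "even (u mod per d) \<longleftrightarrow> even u" using p(1) by (meson dvd_mod_iff)
    then show "even (u mod per d + u)" by simp
  qed
  have first: "(rot i j ^^ m i j) (cyc d t) = cyc d t" if i: "i = lab d t" "t < per d" for t
  proof -
    have j: "j = lab d (Suc t)" using lab_cases[of j d t] ij i by auto
    have step: "rot i j (cyc d ((t + 2 * n) mod per d)) = cyc d ((t + 2 * Suc n) mod per d)" for n
    proof -
      have 1: "i = lab d (t + 2 * n)" using lab_parity[of "t + 2 * n" t d] i by simp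
      have 2: "j = lab d (t + 2 * n + 1)" using lab_parity[of "t + 2 * n + 1" "Suc t" d] j by simp
      have "\<sigma> i (cyc d ((t + 2 * n) mod per d)) = cyc d (flip d i ((t + 2 * n) mod per d))"
        using c lt ij by (intro \<sigma>_cyc) auto
      also have "flip d i ((t + 2 * n) mod per d) = (t + 2 * n + 1) mod per d"
        unfolding flip_def lab_mod using 1 by (simp add: mod_Suc_eq)
      finally have "rot i j (cyc d ((t + 2 * n) mod per d)) = cyc d (flip d j ((t + 2 * n + 1) mod per d))"
        unfolding rot_def using c lt ij by (simp only:) (intro \<sigma>_cyc, auto)
      also have "flip d j ((t + 2 * n + 1) mod per d) = (t + 2 * Suc n) mod per d"
        unfolding flip_def lab_mod using 2 by (simp add: mod_Suc_eq)
      finally show ?thesis .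
    qed
    have "(rot i j ^^ n) (cyc d (t mod per d)) = cyc d ((t + 2 * n) mod per d)" for n
    proof (induction n)
      case (Suc n)
      then show ?case using step[of n] by simp
    qed simp
    from this[of "m i j"] show ?thesis using per i(2) by simp
  qed
  show ?thesis
  proof (cases "i = lab d t")
    case True
    then show ?thesis using first t by blast
  next
    case False
    then have i: "i = lab d (Suc t)" using lab_cases[of i d t] ij by auto
    have fl: "flip d i t < per d" using lt unfolding flip_def by simp
    have "lab d (flip d i t) = lab d (t + per d - 1)" using False lab_mod unfolding flip_def by simp
    also have "\<dots> = lab d (Suc t)" using p by (intro lab_parity) auto
    finally have "(rot i j ^^ m i j) (cyc d (flip d i t)) = cyc d (flip d i t)"
      using first[of "flip d i t"] fl i by simp
    then have "(rot i j ^^ m i j) (\<sigma> i (cyc d t)) = \<sigma> i (cyc d t)"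
      using \<sigma>_cyc[OF c t, of i] ij by simp
    then show ?thesis using rot_fix_first_iff cyc_points[OF c t] ij by blast
  qed
qed

lemma rot_walk:
  "walk E x (concat (replicate n [i, j])) x' \<Longrightarrow> (rot i j ^^ n) (Old x) = Old x'"
proof (induction n arbitrary: x)
  case (Suc n)
  then obtain y z where e: "(x, i, y) \<in> E" "(y, j, z) \<in> E" "walk E z (concat (replicate n [i, j])) x'"
    by auto
  have "rot i j (Old x) = Old z" using e(1,2) hasI nb_eq unfolding rot_def by simp
  then show ?case using Suc.IH[OF e(3)] by (simp add: funpow_swap1)
qed simp

text \<open>Either an edge is missing somewhere in the component of \<open>x\<close>, which then is
  an alternating path on a completed cycle, or the component is closed under both labels.\<close>

lemma rot_Old:
  assumes x: "x \<in> V" and ij: "i \<in> I" "j \<in> I" "i \<noteq> j" "0 < m i j"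
  shows "(rot i j ^^ m i j) (Old x) = Old x"
proof (cases "\<exists>d. is_dart d \<and> labs d = {i, j} \<and> fst d \<in> component {i, j} x")
  case True
  then obtain d where "is_dart d" "labs d = {i, j}" "fst d \<in> component {i, j} x" by blast
  note c = cd_canonical[OF this]
  let ?d = "cd {i, j} x"
  obtain t where t: "t \<le> len ?d" "x = vert ?d t" using c(3) by blast
  have "is_dart ?d" using c(1) unfolding canonical_def by simp
  then have "t < per ?d" using t len(3)[of ?d] by simp
  moreover have "cyc ?d t = Old x" using t unfolding cyc_def by simp
  ultimately show ?thesis using rot_cyc[OF c(1) _ c(2)] ij by metis
next
  case False
  have closed: "\<exists>z'\<in>component {i, j} x. (z, y, z') \<in> E" if z: "z \<in> component {i, j} x" "y \<in> {i, j}" for z y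
  proof -
    have zV: "z \<in> V" using comp_V[OF x] z by blast
    obtain y' where y': "{i, j} = {y, y'}" "y \<noteq> y'" "y' \<in> I" "y \<in> I" "0 < m y y'"
      using z(2) ij m_sym[of i j] by (cases "y = i") auto
    have "has y z"
    proof (rule ccontr)
      assume "\<not> has y z"
      then have "is_dart (z, y, y')" using zV y' by simp
      then show False using False z(1) y'(1) by fastforce
    qed
    then have "(z, y, nb y z) \<in> E" by (rule has_nb)
    then show ?thesis using comp_edge[of z y _ "{i, j}"] z comp_trans by blast
  qed
  have "walk E x (concat (replicate (m i j) [i, j])) x"
    using closed_walk[OF ij comp_V[OF x] closed comp_refl] .
  then show ?thesis by (rule rot_walk)
qed

text \<open>The orbit is a line with this point and next to it the private vertices on its cycles
  for \<open>{i, l}\<close> and \<open>{j, l}\<close>, as far as these pairs are related. Each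
  private vertex is fixed by the other of \<open>i\<close> and \<open>j\<close>. On such a line of
  one, two or three points the rotation has order one, two or three.\<close>

lemma rot_Dart_off:
  assumes q: "Dart x l \<in> points" and l: "l \<noteq> i" "l \<noteq> j" and ij: "i \<in> I" "j \<in> I" "i \<noteq> j" "0 < m i j"
  shows "(rot i j ^^ m i j) (Dart x l) = Dart x l"
proof -
  let ?q = "Dart x l"
  have lI: "l \<in> I" using q unfolding points_def by auto
  have ins: "\<exists>d t. \<sigma> s ?q = Ins d t \<and> labs d = {s, l}" if s: "s \<in> I" "s \<noteq> l" "0 < m s l" for s
  proof -
    have "x \<in> V" "\<not> has l x" using q unfolding points_def by auto
    then have "is_dart (x, l, s)" using s lI m_sym[of s l] by simp
    then have "labs (cd {s, l} x) = {s, l}"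
      using cd_canonical(2)[of "(x, l, s)" "{s, l}" x] comp_refl by auto
    moreover have "\<exists>t. \<sigma> s ?q = Ins (cd {s, l} x) t"
      using s by (simp add: Let_def)
    ultimately show ?thesis by blast
  qed
  have other: "\<sigma> s' (\<sigma> s ?q) = \<sigma> s ?q"
    if s: "s \<in> I" "s \<noteq> l" "0 < m s l" and s': "s' \<noteq> s" "s' \<noteq> l" for s s'
  proof -
    obtain d t where "\<sigma> s ?q = Ins d t" "labs d = {s, l}" using ins[OF s] by blast
    then show ?thesis using s' by simp
  qed
  have inv: "\<sigma> s (\<sigma> s ?q) = ?q" if "s \<in> I" for s using \<sigma>_\<sigma>[OF q that] .
  have ev: "2 dvd m i j" using m_even ij by blast
  consider "m i l = 0" "m j l = 0" | "0 < m i l" "m j l = 0" | "m i l = 0" "0 < m j l"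
    | "0 < m i l" "0 < m j l" by blast
  then show ?thesis
  proof cases
    case 1
    then have "(rot i j ^^ 1) ?q = ?q" using l unfolding rot_def by simp
    then show ?thesis by (rule funpow_dvd_fix) simp
  next
    case 2
    then have f: "\<sigma> j ?q = ?q" using l by simp
    have "rot i j ?q = \<sigma> i ?q" 
      unfolding rot_def by (rule other[OF ij(1) l(1)[symmetric] 2(1) ij(3)[symmetric] l(2)[symmetric]])
    moreover have "rot i j (\<sigma> i ?q) = ?q" unfolding rot_def inv[OF ij(1)] by (rule f)
    ultimately have "(rot i j ^^ 2) ?q = ?q" by (simp add: eval_nat_numeral)
    then show ?thesis using ev by (rule funpow_dvd_fix)
  next
    case 3
    then have f: "\<sigma> i ?q = ?q" using l by simp
    have "rot i j ?q = \<sigma> j ?q" unfolding rot_def f ..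
    moreover have "rot i j (\<sigma> j ?q) = ?q" 
      unfolding rot_def other[OF ij(2) l(2)[symmetric] 3(2) ij(3) l(1)[symmetric]] by (rule inv[OF ij(2)])
    ultimately have "(rot i j ^^ 2) ?q = ?q" by (simp add: eval_nat_numeral)
    then show ?thesis using ev by (rule funpow_dvd_fix)
  next
    case 4
    have "rot i j ?q = \<sigma> i ?q" 
      unfolding rot_def by (rule other[OF ij(1) l(1)[symmetric] 4(1) ij(3)[symmetric] l(2)[symmetric]])
    moreover have "rot i j (\<sigma> i ?q) = \<sigma> j ?q" unfolding rot_def inv[OF ij(1)] ..
    moreover have "rot i j (\<sigma> j ?q) = ?q" 
      unfolding rot_def other[OF ij(2) l(2)[symmetric] 4(2) ij(3) l(1)[symmetric]] by (rule inv[OF ij(2)])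
    ultimately have "(rot i j ^^ 3) ?q = ?q" by (simp add: eval_nat_numeral)
    moreover have "3 dvd m i j" using m_triangle[of i j l] ij l lI 4 by auto
    ultimately show ?thesis by (rule funpow_dvd_fix)
  qed
qed

text \<open>No old vertex is adjacent to an inserted one, since \<open>\<sigma>\<close> leads from
  old vertices to old or shared ones only. A shared neighbour carries the label of \<open>d\<close>
  other than \<open>s\<close>; for a pair of \<open>s\<close> with a label foreign to
  \<open>d\<close> it therefore falls under \<open>rot_Dart_off\<close>.\<close>

lemma Ins_neighbour:
  assumes q: "Ins d t \<in> points" and s: "s \<in> labs d" "s \<in> I"
  shows "(\<exists>t'. \<sigma> s (Ins d t) = Ins d t') \<or> (\<exists>x l. \<sigma> s (Ins d t) = Dart x l \<and> l \<noteq> s \<and> l \<in> labs d)"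
proof -
  have eq: "\<sigma> s (Ins d t) = cyc d (flip d s t)" using s by simp
  have inv: "\<sigma> s (\<sigma> s (Ins d t)) = Ins d t" using \<sigma>_\<sigma>[OF q s(2)] .
  show ?thesis
  proof (cases "\<sigma> s (Ins d t)")
    case (Old x)
    then show ?thesis using inv by (auto split: if_splits)
  next
    case (Dart x l)
    then have "l \<noteq> s" using inv by auto
    moreover have "\<exists>t'. l = lab d t'" using Dart unfolding eq cyc_def by (auto split: if_splits)
    then have "l \<in> labs d" using lab_labs by blast
    ultimately show ?thesis using Dart by blast
  next
    case (Ins d' t')
    then show ?thesis unfolding eq cyc_def by (auto split: if_splits)
  qed
qed

theorem rot_order:
  assumes q: "q \<in> points" and ij: "i \<in> I" "j \<in> I" "i \<noteq> j" "0 < m i j"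
  shows "(rot i j ^^ m i j) q = q"
proof (cases q)
  case (Old x)
  then have "x \<in> V" using q unfolding points_def by auto
  then show ?thesis using rot_Old ij Old by simp
next
  case (Dart x l)
  have x: "x \<in> V" "\<not> has l x" "l \<in> I" using q Dart unfolding points_def by auto
  show ?thesis
  proof (cases "l = i \<or> l = j")
    case True
    then obtain s where s: "{s, l} = {i, j}" "s \<in> I" "s \<noteq> l" "0 < m s l"
      using ij m_sym[of i j] by (cases "l = i") auto
    obtain d t where "canonical d" "labs d = {s, l}" "t < per d" "Dart x l = cyc d t"
      using dart_on_cyc[OF x s(2-)] by blast
    then show ?thesis using rot_cyc[of d t i j] s ij Dart by simp
  next
    case False
    then show ?thesis using rot_Dart_off q ij Dart by simp
  qed
next
  case (Ins d t)
  note c = Ins_on_cyc[OF q[unfolded Ins]]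
  have d: "is_dart d" using c unfolding canonical_def by simp
  have ev: "2 dvd m i j" using m_even ij by blast
  consider "i \<in> labs d" "j \<in> labs d" | "i \<notin> labs d" "j \<notin> labs d"
    | "i \<in> labs d" "j \<notin> labs d" | "i \<notin> labs d" "j \<in> labs d" by blast
  then show ?thesis
  proof cases
    case 1
    then have "labs d = {i, j}" using ij by (cases d) auto
    then show ?thesis using rot_cyc[OF c(1,2) _ ij(3,1,2)] c(3) Ins by simp
  next
    case 2
    then have "(rot i j ^^ 1) q = q" using Ins unfolding rot_def by simp
    then show ?thesis by (rule funpow_dvd_fix) simp
  next
    case 3
    \<comment> \<open>\<open>j\<close> fixes the inserted point. Its neighbour along
      \<open>i\<close> is either fixed by \<open>j\<close> as well, so that the orbit has at most
      two points, or shared, and then the power is checked there and carried back by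
      \<open>\<sigma> i\<close>.\<close>
    have fq: "\<sigma> j q = q" using 3 Ins by simp
    from Ins_neighbour[OF q[unfolded Ins] 3(1) ij(1)] show ?thesis
    proof
      assume "\<exists>t'. \<sigma> i (Ins d t) = Ins d t'"
      then have "\<sigma> j (\<sigma> i q) = \<sigma> i q" using 3 Ins by auto
      then have "(rot i j ^^ 2) q = q"
        using \<sigma>_\<sigma>[OF q ij(1)] fq by (simp add: eval_nat_numeral rot_def)
      then show ?thesis using ev by (rule funpow_dvd_fix)
    next
      assume "\<exists>x l. \<sigma> i (Ins d t) = Dart x l \<and> l \<noteq> i \<and> l \<in> labs d"
      then obtain x l where l: "\<sigma> i q = Dart x l" "l \<noteq> i" "l \<noteq> j" using 3 Ins by auto
      then have "(rot i j ^^ m i j) (\<sigma> i q) = \<sigma> i q"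
        using rot_Dart_off[of x l i j] \<sigma>_points[OF q ij(1)] ij by simp
      then show ?thesis using rot_fix_first_iff q ij by blast
    qed
  next
    case 4
    have fq: "\<sigma> i q = q" using 4 Ins by simp
    from Ins_neighbour[OF q[unfolded Ins] 4(2) ij(2)] show ?thesis
    proof
      assume "\<exists>t'. \<sigma> j (Ins d t) = Ins d t'"
      then have "\<sigma> i (\<sigma> j q) = \<sigma> j q" using 4 Ins by auto
      then have "(rot i j ^^ 2) q = q"
        using \<sigma>_\<sigma>[OF q ij(2)] fq by (simp add: eval_nat_numeral rot_def)
      then show ?thesis using ev by (rule funpow_dvd_fix)
    next
      assume "\<exists>x l. \<sigma> j (Ins d t) = Dart x l \<and> l \<noteq> j \<and> l \<in> labs d"
      then obtain x l where l: "\<sigma> j q = Dart x l" "l \<noteq> i" "l \<noteq> j" using 4 Ins by auto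
      then have "(rot i j ^^ m i j) (\<sigma> j q) = \<sigma> j q"
        using rot_Dart_off[of x l i j] \<sigma>_points[OF q ij(2)] ij by simp
      then show ?thesis using rot_fix_second_iff q ij by blast
    qed
  qed
qed

text \<open>\<open>foldr\<close> applies the last letter first, so words act from the left and the
  letters of a walk appear reversed.\<close>

lemma \<sigma>_walk:
  assumes "walk E x w x'"
  shows "foldr \<sigma> (rev w) (Old x) = Old x'"
  using assms
proof (induction w arbitrary: x)
  case (Cons s w)
  then obtain y where y: "(x, s, y) \<in> E" "walk E y w x'" by auto
  then have "\<sigma> s (Old x) = Old y" using hasI nb_eq by simp
  then show ?case using Cons.IH[OF y(2)] by simp
qed simp

end

section \<open>Index two subgroups and finite quotients\<close>

text \<open>Reidemeister-Schreier rewriting for the kernel of the character \<open>\<chi>\<close>,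
  with transversal \<open>\<one>, t\<close>. Among the \<open>2 * card S\<close> Schreier generators
  is \<open>u t = \<one>\<close>, which accounts for the \<open>- 1\<close>.\<close>

lemma (in group) generate_even_part:
  fixes \<chi> :: "'a \<Rightarrow> bool"
  assumes \<chi>: "\<And>x y. \<lbrakk>x \<in> carrier G; y \<in> carrier G\<rbrakk> \<Longrightarrow> \<chi> (x \<otimes> y) \<longleftrightarrow> \<chi> x \<noteq> \<chi> y"
    and S: "S \<subseteq> carrier G" "finite S" and t: "t \<in> S" "\<chi> t"
  obtains S' where "S' \<subseteq> carrier G" "finite S'" "card S' \<le> 2 * card S - 1"
    "generate G S' = {h \<in> generate G S. \<not> \<chi> h}"
proof -
  have tc: "t \<in> carrier G" using S t by blast
  note [simp] = tc m_assoc
  have [simp]: "t \<otimes> (inv t \<otimes> y) = y" "inv t \<otimes> (t \<otimes> y) = y" if "y \<in> carrier G" for y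
    using that by (simp_all add: m_assoc[symmetric] del: m_assoc)
  have \<chi>1: "\<not> \<chi> \<one>" using \<chi>[of \<one> \<one>] by simp
  have \<chi>i: "\<chi> (inv x) \<longleftrightarrow> \<chi> x" if "x \<in> carrier G" for x
    using \<chi>[of x "inv x"] \<chi>1 that by simp
  define u where "u s = (if \<chi> s then s \<otimes> inv t else s)" for s
  define v where "v s = (if \<chi> s then t \<otimes> s else t \<otimes> s \<otimes> inv t)" for s
  define S' where "S' = u ` (S - {t}) \<union> v ` S"
  define N where "N = generate G S'"
  have uv: "u s \<in> carrier G" "v s \<in> carrier G" if "s \<in> carrier G" for s
    using that unfolding u_def v_def by auto
  have S'c: "S' \<subseteq> carrier G" using S uv unfolding S'_def by blast
  have N: "subgroup N G" unfolding N_def by (rule generate_is_subgroup[OF S'c])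
  interpret N: subgroup N G by (rule N)
  have vN: "v s \<in> N" if "s \<in> S" for s
    using that unfolding N_def S'_def by (intro generate.incl) blast
  have uN: "u s \<in> N" if "s \<in> S" for s
  proof (cases "s = t")
    case True
    then have "u s = \<one>" using t by (simp add: u_def)
    then show ?thesis by simp
  next
    case False
    then show ?thesis using that unfolding N_def S'_def by (intro generate.incl) blast
  qed
  have tt: "t \<otimes> t \<in> N" using vN[OF t(1)] t(2) by (simp add: v_def)
  have conj_gen: "t \<otimes> x \<otimes> inv t \<in> N" if x: "x \<in> S'" for x
  proof -
    consider s where "s \<in> S" "x = u s" | s where "s \<in> S" "x = v s"
      using x unfolding S'_def by blast
    then show ?thesis
    proof cases
      case (1 s)
      then have sc: "s \<in> carrier G" using S by blast
      show ?thesis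
      proof (cases "\<chi> s")
        case True
        have "t \<otimes> x \<otimes> inv t = v s \<otimes> inv (t \<otimes> t)"
          using True 1 sc by (simp add: u_def v_def inv_mult_group)
        also have "\<dots> \<in> N" by (intro N.m_closed N.m_inv_closed vN 1 tt)
        finally show ?thesis .
      next
        case False
        then show ?thesis using 1 vN[OF 1(1)] by (simp add: u_def v_def)
      qed
    next
      case (2 s)
      then have sc: "s \<in> carrier G" using S by blast
      show ?thesis
      proof (cases "\<chi> s")
        case True
        have "t \<otimes> x \<otimes> inv t = (t \<otimes> t) \<otimes> u s"
          using True 2 sc by (simp add: u_def v_def)
        also have "\<dots> \<in> N" by (intro N.m_closed uN 2 tt)
        finally show ?thesis .
      next
        case False
        have "t \<otimes> x \<otimes> inv t = (t \<otimes> t) \<otimes> u s \<otimes> inv (t \<otimes> t)"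
          using False 2 sc by (simp add: u_def v_def inv_mult_group)
        also have "\<dots> \<in> N" by (intro N.m_closed N.m_inv_closed uN 2 tt)
        finally show ?thesis .
      qed
    qed
  qed
  \<comment> \<open>Conjugation lets \<open>t\<close> be moved past elements of \<open>N\<close>, so
    that products of elements of \<open>N\<close> and of its coset through \<open>t\<close> stay in
    the union of the two.\<close>
  have conj: "t \<otimes> x \<otimes> inv t \<in> N" if "x \<in> N" for x
    using that unfolding N_def
  proof (induction x rule: generate.induct)
    case one
    then show ?case using N.one_closed by (simp add: N_def)
  next
    case (incl h)
    then show ?case using conj_gen unfolding N_def by blast
  next
    case (inv h)
    then have "inv (t \<otimes> h \<otimes> inv t) \<in> N" using conj_gen by blast
    moreover have "h \<in> carrier G" using inv S'c by blast
    ultimately show ?case by (simp add: N_def inv_mult_group)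
  next
    case (eng h1 h2)
    have c: "h1 \<in> carrier G" "h2 \<in> carrier G"
      using eng generate_in_carrier[OF S'c] by blast+
    have "(t \<otimes> h1 \<otimes> inv t) \<otimes> (t \<otimes> h2 \<otimes> inv t) \<in> N"
      using eng.IH unfolding N_def[symmetric] by (rule N.m_closed)
    moreover have "(t \<otimes> h1 \<otimes> inv t) \<otimes> (t \<otimes> h2 \<otimes> inv t) = t \<otimes> (h1 \<otimes> h2) \<otimes> inv t"
      using c by simp
    ultimately show ?case unfolding N_def[symmetric] by simp
  qed
  have conj': "inv t \<otimes> x \<otimes> t \<in> N" if x: "x \<in> N" for x
  proof -
    have "x \<in> carrier G" using x by simp
    then have "inv t \<otimes> x \<otimes> t = inv (t \<otimes> t) \<otimes> (t \<otimes> x \<otimes> inv t) \<otimes> (t \<otimes> t)"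
      by (simp add: inv_mult_group)
    also have "\<dots> \<in> N" by (intro N.m_closed N.m_inv_closed conj x tt)
    finally show ?thesis .
  qed
  have \<chi>uv: "\<not> \<chi> (u s)" "\<not> \<chi> (v s)" if "s \<in> carrier G" for s
    using that t(2) by (simp_all add: u_def v_def \<chi> \<chi>i del: m_assoc)
  have \<chi>S': "\<not> \<chi> x" if "x \<in> S'" for x
    using that \<chi>uv S(1) unfolding S'_def by blast
  have \<chi>N: "\<not> \<chi> x" if "x \<in> N" for x
    using that unfolding N_def
  proof (induction x rule: generate.induct)
    case one
    then show ?case by (rule \<chi>1)
  next
    case (incl h)
    then show ?case by (rule \<chi>S')
  next
    case (inv h)
    then have "h \<in> carrier G" "\<not> \<chi> h" using S'c \<chi>S' by blast+
    then show ?case using \<chi>i by simp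
  next
    case (eng h1 h2)
    then show ?case using \<chi> generate_in_carrier[OF S'c] by simp
  qed
  have M: "h \<in> N \<or> h \<otimes> inv t \<in> N" if "h \<in> generate G S" for h
    using that
  proof (induction h rule: generate.induct)
    case one
    then show ?case by simp
  next
    case (incl h)
    then show ?case using uN[of h] unfolding u_def by (auto split: if_splits)
  next
    case (inv h)
    then have hc: "h \<in> carrier G" using S by blast
    show ?case
    proof (cases "\<chi> h")
      case True
      then have "inv (v h) \<otimes> \<one> \<in> N" using vN[OF inv] by simp
      then have "inv (v h) \<in> N" using uv hc by simp
      moreover have "inv (v h) = inv h \<otimes> inv t" using True hc by (simp add: v_def inv_mult_group)
      ultimately show ?thesis by simp
    next
      case False
      then have "inv h \<in> N" using uN[OF inv] by (simp add: u_def)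
      then show ?thesis ..
    qed
  next
    case (eng h1 h2)
    have c: "h1 \<in> carrier G" "h2 \<in> carrier G"
      using eng generate_in_carrier[OF S(1)] by blast+
    from eng.IH show ?case
    proof (elim disjE)
      assume "h1 \<in> N" "h2 \<in> N"
      then show ?thesis by simp
    next
      assume "h1 \<in> N" "h2 \<otimes> inv t \<in> N"
      then have "h1 \<otimes> (h2 \<otimes> inv t) \<in> N" by (rule N.m_closed)
      then show ?thesis using c by simp
    next
      assume h: "h1 \<otimes> inv t \<in> N" "h2 \<in> N"
      have "(h1 \<otimes> inv t) \<otimes> (t \<otimes> h2 \<otimes> inv t) \<in> N"
        by (rule N.m_closed[OF h(1) conj[OF h(2)]])
      moreover have "(h1 \<otimes> inv t) \<otimes> (t \<otimes> h2 \<otimes> inv t) = (h1 \<otimes> h2) \<otimes> inv t"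
        using c by simp
      ultimately show ?thesis by simp
    next
      assume h: "h1 \<otimes> inv t \<in> N" "h2 \<otimes> inv t \<in> N"
      have "(h1 \<otimes> inv t) \<otimes> ((t \<otimes> (h2 \<otimes> inv t) \<otimes> inv t) \<otimes> (t \<otimes> t)) \<in> N"
        by (rule N.m_closed[OF h(1) N.m_closed[OF conj[OF h(2)] tt]])
      moreover have "(h1 \<otimes> inv t) \<otimes> ((t \<otimes> (h2 \<otimes> inv t) \<otimes> inv t) \<otimes> (t \<otimes> t)) = h1 \<otimes> h2"
        using c by simp
      ultimately show ?thesis by simp
    qed
  qed
  have NS: "N \<subseteq> generate G S"
  proof -
    have sub: "subgroup (generate G S) G" by (rule generate_is_subgroup[OF S(1)])
    interpret S: subgroup "generate G S" G by (rule sub)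
    have g: "s \<in> generate G S" if "s \<in> S" for s using that by (rule generate.incl)
    have "S' \<subseteq> generate G S"
      using g t(1) unfolding S'_def u_def v_def by auto
    then show ?thesis unfolding N_def by (rule generate_subgroup_incl[OF _ sub])
  qed
  have "N = {h \<in> generate G S. \<not> \<chi> h}"
  proof (intro equalityI subsetI)
    fix h assume "h \<in> N"
    then show "h \<in> {h \<in> generate G S. \<not> \<chi> h}" using NS \<chi>N by blast
  next
    fix h assume h: "h \<in> {h \<in> generate G S. \<not> \<chi> h}"
    then have "h \<in> carrier G" using generate_in_carrier[OF S(1)] by blast
    then have "h \<otimes> inv t \<notin> N" using h \<chi>N[of "h \<otimes> inv t"] t(2) by (auto simp: \<chi> \<chi>i)
    then show "h \<in> N" using M h by blast
  qed
  moreover have "card S' \<le> 2 * card S - 1"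
  proof -
    have "card S' \<le> card (u ` (S - {t})) + card (v ` S)" unfolding S'_def by (rule card_Un_le)
    also have "\<dots> \<le> card (S - {t}) + card S" using S by (intro add_mono card_image_le) auto
    also have "\<dots> = 2 * card S - 1"
      using S t card_gt_0_iff[of S] by (auto simp: card_Diff_singleton)
    finally show ?thesis .
  qed
  moreover have "finite S'" using S unfolding S'_def by simp
  ultimately show ?thesis using that S'c unfolding N_def by blast
qed

text \<open>Cutting \<open>L\<close> down to the image of \<open>\<psi>\<close> supplies the
  surjectivity that separability asks for.\<close>

lemma finite_hom_witness:
  fixes L :: "('c, 'd) monoid_scheme"
  assumes G: "group G" and L: "group L" "finite (carrier L)" and \<psi>: "\<psi> \<in> hom G L"
    and H: "H \<subseteq> carrier G" and g: "g \<in> carrier G" and sep: "\<psi> g \<notin> \<psi> ` H"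
  shows "\<exists>(K :: nat monoid) \<phi>. group K \<and> finite (carrier K) \<and> \<phi> \<in> epi G K \<and> \<phi> g \<notin> \<phi> ` H"
proof (rule finite_quotient_nat)
  interpret gh: group_hom G L \<psi>
    using G L \<psi> by (simp add: group_hom_def group_hom_axioms_def)
  show "group (L\<lparr>carrier := \<psi> ` carrier G\<rparr>)"
    using gh.img_is_subgroup subgroup.subgroup_is_group L(1) by blast
  show "finite (carrier (L\<lparr>carrier := \<psi> ` carrier G\<rparr>))"
    using gh.img_is_subgroup L(2) by (auto intro: finite_subset dest: subgroup.subset)
  show "\<psi> \<in> epi G (L\<lparr>carrier := \<psi> ` carrier G\<rparr>)"
    using \<psi> unfolding epi_def hom_def by auto
qed (use H g sep in auto)

text \<open>\<open>H\<close> is covered by \<open>N\<close> and its coset through \<open>t\<close>.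
  To keep \<open>g\<close> away from that coset is to keep \<open>g \<otimes> inv t\<close> away
  from \<open>N\<close>, so a product of two finite quotients separates \<open>g\<close> from all of
  \<open>H\<close>.\<close>

lemma separable_of_index_two:
  fixes G (structure)
  assumes G: "group G" and H: "subgroup H G" and N: "separable_in G N" and NH: "N \<subseteq> H"
    and t: "t \<in> H" and cov: "\<And>h. h \<in> H \<Longrightarrow> h \<in> N \<or> h \<otimes>\<^bsub>G\<^esub> inv\<^bsub>G\<^esub> t \<in> N"
  shows "separable_in G H"
  unfolding separable_in_def
proof (intro conjI ballI H)
  interpret group G by (rule G)
  interpret H: subgroup H G by (rule H)
  fix g assume g: "g \<in> carrier G - H"
  have tc: "t \<in> carrier G" using t by simp
  have g2: "g \<otimes> inv t \<in> carrier G - H"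
  proof -
    have "g \<in> H" if "g \<otimes> inv t \<in> H"
    proof -
      have "(g \<otimes> inv t) \<otimes> t \<in> H" using that t by simp
      then show ?thesis using g tc by (simp add: m_assoc)
    qed
    then show ?thesis using g tc by auto
  qed
  obtain K1 :: "nat monoid" and \<psi>1 where 1: "group K1" "finite (carrier K1)" "\<psi>1 \<in> epi G K1"
    "\<psi>1 g \<notin> \<psi>1 ` N"
    using N g NH unfolding separable_in_def by blast
  obtain K2 :: "nat monoid" and \<psi>2 where 2: "group K2" "finite (carrier K2)" "\<psi>2 \<in> epi G K2"
    "\<psi>2 (g \<otimes> inv t) \<notin> \<psi>2 ` N"
    using N g2 NH unfolding separable_in_def by blast
  have h: "\<psi>1 \<in> hom G K1" "\<psi>2 \<in> hom G K2" using 1 2 unfolding epi_def by auto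
  interpret h2: group_hom G K2 \<psi>2 using G 2 h by (simp add: group_hom_def group_hom_axioms_def)
  let ?\<psi> = "\<lambda>x. (\<psi>1 x, \<psi>2 x)"
  show "\<exists>(K :: nat monoid) \<psi>. group K \<and> finite (carrier K) \<and> \<psi> \<in> epi G K \<and> \<psi> g \<notin> \<psi> ` H"
  proof (rule finite_hom_witness[where \<psi> = ?\<psi> and L = "K1 \<times>\<times> K2"])
    show "group (K1 \<times>\<times> K2)" using 1 2 by (simp add: DirProd_group)
    show "finite (carrier (K1 \<times>\<times> K2))" using 1 2 by simp
    show "?\<psi> \<in> hom G (K1 \<times>\<times> K2)" using h unfolding hom_def by auto
    show "?\<psi> g \<notin> ?\<psi> ` H"
    proof
      assume "?\<psi> g \<in> ?\<psi> ` H"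
      then obtain x where x: "x \<in> H" "\<psi>1 g = \<psi>1 x" "\<psi>2 g = \<psi>2 x" by auto
      from cov[OF x(1)] show False
      proof
        assume "x \<in> N"
        then show False using 1(4) x(2) by blast
      next
        assume *: "x \<otimes> inv t \<in> N"
        have "\<psi>2 (g \<otimes> inv t) = \<psi>2 (x \<otimes> inv t)" using x g tc by simp
        then show False using 2(4) * by blast
      qed
    qed
  qed (use G H g H.subset in auto)
qed

section \<open>Coxeter groups\<close>

context partial_action
begin

lemma foldr_\<sigma>_points: "q \<in> points \<Longrightarrow> set w \<subseteq> I \<Longrightarrow> foldr \<sigma> w q \<in> points"
  by (induction w) (auto simp: \<sigma>_points)

lemma foldr_\<sigma>_rev: "q \<in> points \<Longrightarrow> set w \<subseteq> I \<Longrightarrow> foldr \<sigma> (rev w) (foldr \<sigma> w q) = q"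
  by (induction w) (auto simp: \<sigma>_\<sigma> foldr_\<sigma>_points)

lemma foldr_\<sigma>_Bij:
  assumes "set w \<subseteq> I"
  shows "restrict (foldr \<sigma> w) points \<in> Bij points"
proof -
  have "bij_betw (foldr \<sigma> w) points points"
    by (rule bij_betw_byWitness[where f' = "foldr \<sigma> (rev w)"])
      (use assms foldr_\<sigma>_rev[of _ w] foldr_\<sigma>_rev[of _ "rev w"] foldr_\<sigma>_points[of _ w]
        foldr_\<sigma>_points[of _ "rev w"] in auto)
  then show ?thesis unfolding Bij_def by (simp add: bij_betw_restrict_eq)
qed

lemma foldr_\<sigma>_alternating: "foldr \<sigma> (concat (replicate p [i, j])) q = (rot j i ^^ p) q"
  by (induction p) (auto simp: rot_def)

end

section \<open>Words and parity in a Coxeter group\<close>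

locale coxeter =
  fixes n :: nat and m :: "nat \<Rightarrow> nat \<Rightarrow> enat"
begin

abbreviation "I \<equiv> {1..n}"
abbreviation "G \<equiv> coxeter_group n m"
abbreviation "cls \<equiv> \<lambda>u. word_rel {1..n} (coxeter_relators n m) `` {u}"

sublocale group G by (rule group_coxeter_group)

lemma carrier_cls: "carrier G = cls ` words I"
  unfolding coxeter_group_def presented_group_def quotient_def by auto

lemma cls_mult: "u \<in> words I \<Longrightarrow> v \<in> words I \<Longrightarrow> cls u \<otimes>\<^bsub>G\<^esub> cls v = cls (u @ v)"
  using presented_group_mult[OF coxeter_relators_words] unfolding coxeter_group_def by blast

lemma cls_one: "\<one>\<^bsub>G\<^esub> = cls []"
  unfolding coxeter_group_def presented_group_def by simp

lemma cls_eq: "(u, v) \<in> word_rel I (coxeter_relators n m) \<Longrightarrow> cls u = cls v"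
  using equiv_class_eq[OF equiv_word_rel[OF coxeter_relators_words]] .

text \<open>Letters outside \<open>I\<close> are ignored, so that every list has a value.\<close>

definition ev :: "nat list \<Rightarrow> nat word set" where
  "ev w = cls (map (\<lambda>i. (i, False)) (filter (\<lambda>i. i \<in> I) w))"

lemma ev_carrier: "ev w \<in> carrier G"
  unfolding ev_def carrier_cls by (intro imageI) auto

lemma ev_append: "ev (u @ v) = ev u \<otimes>\<^bsub>G\<^esub> ev v"
  unfolding ev_def by (subst cls_mult) auto

lemma ev_Nil: "ev [] = \<one>\<^bsub>G\<^esub>"
  unfolding ev_def cls_one by simp

lemma ev_square: "ev [i, i] = \<one>\<^bsub>G\<^esub>"
proof (cases "i \<in> I")
  case True
  then have "[(i, False), (i, False)] \<in> coxeter_relators n m" unfolding coxeter_relators_def by auto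
  from word_rel.relator[OF _ _ this, of "[]" I "[]"]
  have "cls [(i, False), (i, False)] = cls []" by (intro cls_eq) simp
  then show ?thesis unfolding ev_def cls_one using True by simp
next
  case False
  then show ?thesis unfolding ev_def cls_one by auto
qed

lemma ev_rev: "ev (rev w) = inv\<^bsub>G\<^esub> ev w"
proof (induction w)
  case Nil
  then show ?case by (simp add: ev_Nil)
next
  case (Cons i w)
  have "ev [i] \<otimes>\<^bsub>G\<^esub> ev [i] = \<one>\<^bsub>G\<^esub>" using ev_square ev_append[of "[i]" "[i]"] by simp
  then have i: "inv\<^bsub>G\<^esub> ev [i] = ev [i]" using ev_carrier inv_equality by blast
  have "ev (rev (i # w)) = inv\<^bsub>G\<^esub> ev w \<otimes>\<^bsub>G\<^esub> inv\<^bsub>G\<^esub> ev [i]"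
    using Cons by (simp add: ev_append i)
  also have "\<dots> = inv\<^bsub>G\<^esub> (ev ([i] @ w))"
    unfolding ev_append by (simp add: inv_mult_group ev_carrier)
  finally show ?case by simp
qed

text \<open>In a word consisting of a generator twice and then its formal inverse, either the square
  or the inverse pair can be removed; hence a generator equals its formal inverse.\<close>

lemma cls_unsigned:
  assumes "u \<in> words I"
  shows "cls u = cls (map (\<lambda>l. (fst l, False)) u)"
  using assms
proof (induction u)
  case (Cons l u)
  obtain x b where l: "l = (x, b)" by (cases l)
  have x: "x \<in> I" "u \<in> words I" using Cons l by auto
  have flip: "cls [(x, True)] = cls [(x, False)]"
  proof -
    have "[(x, False), (x, False)] \<in> coxeter_relators n m"
      using x unfolding coxeter_relators_def by auto
    from word_rel.relator[OF _ _ this, of "[]" I "[(x, True)]"]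
    have 1: "cls [(x, False), (x, False), (x, True)] = cls [(x, True)]"
      using x by (intro cls_eq) simp
    from word_rel.cancel[of "[(x, False)]" I "[]" x False]
    have "cls [(x, False), (x, False), (x, True)] = cls [(x, False)]"
      using x by (intro cls_eq) simp
    then show ?thesis using 1 by simp
  qed
  have "cls (l # u) = cls [l] \<otimes>\<^bsub>G\<^esub> cls u" using cls_mult[of "[l]" u] x l by simp
  also have "cls [l] = cls [(x, False)]" using l flip by (cases b) auto
  also have "cls u = cls (map (\<lambda>l. (fst l, False)) u)" using Cons x by blast
  also have "cls [(x, False)] \<otimes>\<^bsub>G\<^esub> \<dots> = cls ([(x, False)] @ map (\<lambda>l. (fst l, False)) u)"
    using x by (intro cls_mult) (auto simp: in_lists_conv_set)
  finally show ?case using l by simp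
qed simp

lemma ev_surj:
  assumes "x \<in> carrier G"
  obtains w where "w \<in> lists I" "ev w = x"
proof -
  obtain u where u: "u \<in> words I" "x = cls u" using assms unfolding carrier_cls by blast
  have "set (map fst u) \<subseteq> I" using u by auto
  moreover from this have "filter (\<lambda>i. i \<in> I) (map fst u) = map fst u"
    by (intro filter_True) blast
  then have "ev (map fst u) = x" unfolding ev_def using cls_unsigned[OF u(1)] u(2) by (simp add: o_def)
  ultimately show ?thesis using that by (metis in_lists_conv_set subsetD)
qed

lemma ev_relator:
  assumes "i \<in> I" "j \<in> I" "i \<noteq> j" "m i j = enat p" "m j i = enat p"
  shows "ev (concat (replicate p [i, j])) = \<one>\<^bsub>G\<^esub>"
proof -
  have less: "ev (concat (replicate p [i, j])) = \<one>\<^bsub>G\<^esub>"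
    if ij: "i \<in> I" "j \<in> I" "i < j" "m i j = enat p" for i j
  proof -
    let ?r = "concat (replicate p [(i, False), (j, False)])"
    have "?r \<in> coxeter_relators n m" unfolding coxeter_relators_def using ij by blast
    from word_rel.relator[OF _ _ this, of "[]" I "[]"] have "cls ?r = cls []" by (intro cls_eq) simp
    moreover have "map (\<lambda>i. (i, False)) (filter (\<lambda>i. i \<in> I) (concat (replicate q [i, j]))) =
        concat (replicate q [(i, False), (j, False)])" for q
      using ij(1,2) by (induction q) auto
    ultimately show ?thesis unfolding ev_def cls_one by simp
  qed
  show ?thesis
  proof (cases "i < j")
    case True
    then show ?thesis using less assms by blast
  next
    case False
    have "concat (replicate p [i, j]) = rev (concat (replicate p [j, i]))"
      by (simp add: rev_concat)
    then show ?thesis using False less[of j i] assms by (simp add: ev_rev)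
  qed
qed

lemma coxeter_gen_ev: "i \<in> I \<Longrightarrow> coxeter_gen n m i = ev [i]"
  unfolding coxeter_gen_def presented_gen_def ev_def by simp

text \<open>Word length modulo two is well defined since all relators have even length.\<close>

definition odd_elt :: "nat word set \<Rightarrow> bool" where
  "odd_elt A \<longleftrightarrow> (\<exists>u\<in>A. odd (length u))"

lemma odd_elt_cls:
  assumes "u \<in> words I"
  shows "odd_elt (cls u) \<longleftrightarrow> odd (length u)"
proof -
  have len: "even (length u) \<longleftrightarrow> even (length v)" if "(u, v) \<in> word_rel I (coxeter_relators n m)" for u v
    using that
  proof (induction rule: word_rel.induct)
    case (relator u v r)
    have "length (concat (replicate p [a, b])) = 2 * p" for p and a b :: "nat \<times> bool"
      by (induction p) auto
    then have "even (length r)" using relator unfolding coxeter_relators_def by auto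
    then show ?case by simp
  qed auto
  have "u \<in> cls u" using word_rel.refl[OF assms] by blast
  then show ?thesis using len unfolding odd_elt_def by blast
qed

lemma odd_elt_mult:
  assumes "x \<in> carrier G" "y \<in> carrier G"
  shows "odd_elt (x \<otimes>\<^bsub>G\<^esub> y) \<longleftrightarrow> odd_elt x \<noteq> odd_elt y"
proof -
  obtain u v where u: "u \<in> words I" "x = cls u" and v: "v \<in> words I" "y = cls v"
    using assms unfolding carrier_cls by blast
  have uv: "u @ v \<in> words I" using u v by simp
  show ?thesis
    unfolding u(2) v(2) cls_mult[OF u(1) v(1)] odd_elt_cls[OF u(1)] odd_elt_cls[OF v(1)] odd_elt_cls[OF uv]
    by simp
qed

lemma odd_elt_one: "\<not> odd_elt \<one>\<^bsub>G\<^esub>"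
  unfolding cls_one using odd_elt_cls[of "[]"] by simp

lemma odd_elt_inv: "g \<in> carrier G \<Longrightarrow> odd_elt (inv\<^bsub>G\<^esub> g) \<longleftrightarrow> odd_elt g"
  using odd_elt_mult[of g "inv\<^bsub>G\<^esub> g"] odd_elt_one by simp

text \<open>Parity is a homomorphism, so conjugation preserves it. Subgroups of even elements
  thereby contain no conjugate of a generator, and the first part of the theorem applies to
  them.\<close>

lemma odd_elt_conj_gen:
  assumes "i \<in> I" "g \<in> carrier G"
  shows "odd_elt (g \<otimes>\<^bsub>G\<^esub> coxeter_gen n m i \<otimes>\<^bsub>G\<^esub> inv\<^bsub>G\<^esub> g)"
proof -
  have gen: "coxeter_gen n m i \<in> carrier G" unfolding coxeter_gen_ev[OF assms(1)] by (rule ev_carrier)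
  have w: "[(i, False)] \<in> words I" using assms(1) by auto
  have odd: "odd_elt (coxeter_gen n m i)"
    unfolding coxeter_gen_def presented_gen_def odd_elt_cls[OF w] by simp
  show ?thesis using gen odd assms(2) by (simp add: odd_elt_mult odd_elt_inv)
qed

lemma coset_word_action:
  assumes H: "subgroup H G"
    and noconj: "\<forall>i\<in>I. \<forall>g\<in>carrier G. g \<otimes>\<^bsub>G\<^esub> coxeter_gen n m i \<otimes>\<^bsub>G\<^esub> inv\<^bsub>G\<^esub> g \<notin> H"
  shows "word_action I ev (rcosets\<^bsub>G\<^esub> H) (\<lambda>c i. c #>\<^bsub>G\<^esub> ev [i])"
    and "c \<in> rcosets\<^bsub>G\<^esub> H \<Longrightarrow> foldl (\<lambda>c i. c #>\<^bsub>G\<^esub> ev [i]) c w = c #>\<^bsub>G\<^esub> ev w"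
proof -
  have Hc: "H \<subseteq> carrier G" using H subgroup.subset by blast
  have sub: "c \<subseteq> carrier G" if "c \<in> rcosets\<^bsub>G\<^esub> H" for c
    using that Hc rcosets_part_G[OF H] by blast
  have closed: "c #>\<^bsub>G\<^esub> ev u \<in> rcosets\<^bsub>G\<^esub> H" if c: "c \<in> rcosets\<^bsub>G\<^esub> H" for c u
  proof -
    obtain x where x: "x \<in> carrier G" "c = H #>\<^bsub>G\<^esub> x" using c unfolding RCOSETS_def by blast
    show ?thesis unfolding x(2) coset_mult_assoc[OF Hc x(1) ev_carrier]
      by (intro rcosetsI[OF Hc] m_closed x(1) ev_carrier)
  qed
  have fold: "foldl (\<lambda>c i. c #>\<^bsub>G\<^esub> ev [i]) c w = c #>\<^bsub>G\<^esub> ev w"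
    if "c \<in> rcosets\<^bsub>G\<^esub> H" for c w
    using that
  proof (induction w arbitrary: c)
    case Nil
    then show ?case using coset_mult_one[OF sub] ev_Nil by simp
  next
    case (Cons i w)
    have "foldl (\<lambda>c i. c #>\<^bsub>G\<^esub> ev [i]) c (i # w) = (c #>\<^bsub>G\<^esub> ev [i]) #>\<^bsub>G\<^esub> ev w"
      using Cons.IH[OF closed[OF Cons.prems]] by simp
    also have "\<dots> = c #>\<^bsub>G\<^esub> (ev [i] \<otimes>\<^bsub>G\<^esub> ev w)"
      using coset_mult_assoc[OF sub[OF Cons.prems]] ev_carrier by simp
    also have "\<dots> = c #>\<^bsub>G\<^esub> ev (i # w)" using ev_append[of "[i]" w] by simp
    finally show ?case .
  qed
  show "c \<in> rcosets\<^bsub>G\<^esub> H \<Longrightarrow> foldl (\<lambda>c i. c #>\<^bsub>G\<^esub> ev [i]) c w = c #>\<^bsub>G\<^esub> ev w"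
    by (rule fold)
  show "word_action I ev (rcosets\<^bsub>G\<^esub> H) (\<lambda>c i. c #>\<^bsub>G\<^esub> ev [i])"
  proof unfold_locales
    show "ev (u @ v) = ev (u' @ v')" if "ev u = ev u'" "ev v = ev v'" for u u' v v'
      using that by (simp add: ev_append)
    show "ev [i, i] = ev []" for i by (simp add: ev_square ev_Nil)
    show "c #>\<^bsub>G\<^esub> ev [i] \<in> rcosets\<^bsub>G\<^esub> H" if "c \<in> rcosets\<^bsub>G\<^esub> H" for c i using closed[OF that] .
    show "foldl (\<lambda>c i. c #>\<^bsub>G\<^esub> ev [i]) c u = foldl (\<lambda>c i. c #>\<^bsub>G\<^esub> ev [i]) c v"
      if "c \<in> rcosets\<^bsub>G\<^esub> H" "ev u = ev v" for c u v
      using fold[OF that(1)] that(2) by simp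
    show "c #>\<^bsub>G\<^esub> ev [i] \<noteq> c" if c: "c \<in> rcosets\<^bsub>G\<^esub> H" and i: "i \<in> I" for c i
    proof
      assume eq: "c #>\<^bsub>G\<^esub> ev [i] = c"
      obtain x where x: "x \<in> carrier G" "c = H #>\<^bsub>G\<^esub> x" using c unfolding RCOSETS_def by blast
      have xi: "x \<otimes>\<^bsub>G\<^esub> ev [i] \<in> carrier G" using x ev_carrier by simp
      have "H #>\<^bsub>G\<^esub> (x \<otimes>\<^bsub>G\<^esub> ev [i]) = H #>\<^bsub>G\<^esub> x"
        using eq x coset_mult_assoc[OF Hc x(1) ev_carrier] by simp
      \<comment> \<open>A fixed coset of \<open>x\<close> would put the conjugate of the generator
        by \<open>x\<close> into \<open>H\<close>.\<close>
      then have "H #>\<^bsub>G\<^esub> (x \<otimes>\<^bsub>G\<^esub> ev [i] \<otimes>\<^bsub>G\<^esub> inv\<^bsub>G\<^esub> x) = H"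
        using coset_mult_inv2 xi x Hc by blast
      then have "x \<otimes>\<^bsub>G\<^esub> ev [i] \<otimes>\<^bsub>G\<^esub> inv\<^bsub>G\<^esub> x \<in> H"
        using coset_join1[OF _ _ H] xi x by simp
      then show False using noconj i x(1) unfolding coxeter_gen_ev[OF i, symmetric] by blast
    qed
  qed
qed

end

section \<open>The Coxeter group acts on the completion\<close>

locale coxeter_completion = coxeter n m + partial_action "{1..n}" V E ex
  for n :: nat and m :: "nat \<Rightarrow> nat \<Rightarrow> enat" and V :: "nat set" and E ex +
  assumes exponent: "\<lbrakk>i \<in> I; j \<in> I; i < j; m i j = enat p\<rbrakk> \<Longrightarrow> ex i j = p \<and> 0 < p"
begin

lemma word_rel_action:
  assumes "(u, v) \<in> word_rel I (coxeter_relators n m)" "q \<in> points"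
  shows "foldr \<sigma> (map fst u) q = foldr \<sigma> (map fst v) q"
  using assms
proof (induction arbitrary: q rule: word_rel.induct)
  case (cancel u v x b)
  have "set (map fst v) \<subseteq> I" using cancel by auto
  then have "foldr \<sigma> (map fst v) q \<in> points" using cancel foldr_\<sigma>_points by blast
  then show ?case using \<sigma>_\<sigma>[OF _ cancel(3)] by simp
next
  case (relator u v r)
  let ?q = "foldr \<sigma> (map fst v) q"
  have "set (map fst v) \<subseteq> I" using relator by auto
  then have q: "?q \<in> points" using relator foldr_\<sigma>_points by blast
  have "foldr \<sigma> (map fst r) ?q = ?q"
  proof -
    from relator(3) consider i where "i \<in> I" "r = [(i, False), (i, False)]"
      | i j p where "i \<in> I" "j \<in> I" "i < j" "m i j = enat p" "r = concat (replicate p [(i, False), (j, False)])"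
      unfolding coxeter_relators_def by blast
    then show ?thesis
    proof cases
      case 1
      then show ?thesis using \<sigma>_\<sigma>[OF q 1(1)] by simp
    next
      case 2
      have "map fst (concat (replicate p [(i, False), (j, False)])) = concat (replicate p [i, j])" for p
        by (induction p) auto
      then have r: "map fst r = concat (replicate p [i, j])" using 2 by simp
      \<comment> \<open>\<open>foldr\<close> applies \<open>j\<close> first, so the relator acts as
        a power of \<open>rot j i\<close>, and the exponent is wanted with its arguments
        swapped.\<close>
      have p: "ex j i = p" "0 < ex j i" using exponent[OF 2(1-4)] m_sym[of i j] by auto
      then show ?thesis unfolding r foldr_\<sigma>_alternating
        using rot_order[OF q 2(2,1) _ p(2)] 2(3) by simp
    qed
  qed
  then show ?case by simp
qed auto

definition perm :: "nat word \<Rightarrow> point \<Rightarrow> point" where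
  "perm u = restrict (foldr \<sigma> (map fst u)) points"

text \<open>The choice of a representative is harmless because words of one class act alike on
  \<open>points\<close>.\<close>

definition act_hom :: "nat word set \<Rightarrow> point \<Rightarrow> point" where
  "act_hom A = perm (SOME u. u \<in> A)"

lemma act_hom_cls:
  assumes "u \<in> words I"
  shows "act_hom (cls u) = perm u"
proof -
  have "u \<in> cls u" using word_rel.refl[OF assms] by blast
  then have "(SOME v. v \<in> cls u) \<in> cls u" by (rule someI)
  then have "(u, SOME v. v \<in> cls u) \<in> word_rel I (coxeter_relators n m)" by blast
  from word_rel_action[OF this] show ?thesis
    unfolding act_hom_def perm_def by (intro restrict_ext) simp
qed

lemma perm_Bij: "u \<in> words I \<Longrightarrow> perm u \<in> Bij points"
  unfolding perm_def by (intro foldr_\<sigma>_Bij) auto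

lemma act_hom: "act_hom \<in> hom G (BijGroup points)"
proof (rule homI)
  fix x assume "x \<in> carrier G"
  then obtain u where u: "u \<in> words I" "x = cls u" unfolding carrier_cls by blast
  show "act_hom x \<in> carrier (BijGroup points)"
    unfolding u(2) act_hom_cls[OF u(1)] using perm_Bij[OF u(1)] by (simp add: BijGroup_def)
next
  fix x y assume "x \<in> carrier G" "y \<in> carrier G"
  then obtain u v where u: "u \<in> words I" "x = cls u" and v: "v \<in> words I" "y = cls v"
    unfolding carrier_cls by blast
  have uv: "u @ v \<in> words I" using u v by simp
  have vI: "set (map fst v) \<subseteq> I" using v by auto
  have "perm (u @ v) = compose points (perm u) (perm v)"
  proof
    fix q
    show "perm (u @ v) q = compose points (perm u) (perm v) q"
      using foldr_\<sigma>_points[OF _ vI, of q] unfolding perm_def compose_def by simp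
  qed
  then show "act_hom (x \<otimes>\<^bsub>G\<^esub> y) = act_hom x \<otimes>\<^bsub>BijGroup points\<^esub> act_hom y"
    unfolding u(2) v(2) cls_mult[OF u(1) v(1)] act_hom_cls[OF u(1)] act_hom_cls[OF v(1)] act_hom_cls[OF uv]
    using perm_Bij u(1) v(1) by (simp add: BijGroup_def)
qed

lemma act_hom_ev:
  assumes "w \<in> lists I" "q \<in> points"
  shows "act_hom (ev w) q = foldr \<sigma> w q"
proof -
  have "filter (\<lambda>i. i \<in> I) w = w" using assms(1) by (intro filter_True) blast
  then have ev: "ev w = cls (map (\<lambda>i. (i, False)) w)" unfolding ev_def by (simp only:)
  have "map (\<lambda>i. (i, False)) w \<in> words I" using assms(1) by auto
  from act_hom_cls[OF this] show ?thesis unfolding ev perm_def using assms(2) by (simp add: o_def)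
qed

end

section \<open>Separating an element from the subgroup\<close>

context coxeter
begin

lemma separable_without_conjugates:
  assumes exps: "coxeter_exponents n m"
    and large: "\<forall>i\<in>I. \<forall>j\<in>I. i < j \<longrightarrow> m i j \<ge> enat (3 * k + 7)"
    and sep: "separability_condition n m"
    and S: "S \<subseteq> carrier G" "finite S" "card S \<le> k" and H: "H = generate G S"
    and noconj: "\<forall>i\<in>I. \<forall>g\<in>carrier G. g \<otimes>\<^bsub>G\<^esub> coxeter_gen n m i \<otimes>\<^bsub>G\<^esub> inv\<^bsub>G\<^esub> g \<notin> H"
  shows "separable_in G H"
  unfolding separable_in_def
proof (intro conjI ballI)
  show sub: "subgroup H G" unfolding H by (rule generate_is_subgroup[OF S(1)])
  have Hc: "H \<subseteq> carrier G" using sub subgroup.subset by blast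
  fix g assume g: "g \<in> carrier G - H"
  have "\<exists>w. w \<in> lists I \<and> ev w = s" if s: "s \<in> S" for s
  proof -
    have "s \<in> carrier G" using s S(1) by blast
    from ev_surj[OF this] show ?thesis by metis
  qed
  then obtain W where W: "\<And>s. s \<in> S \<Longrightarrow> W s \<in> lists I \<and> ev (W s) = s" by metis
  define T where "T = W ` S"
  \<comment> \<open>Walks follow the right action on cosets, while words act on the completion from
    the left. A walk from \<open>a\<close> to \<open>b\<close> reading the inverse of
    \<open>g\<close> therefore makes \<open>g\<close> send \<open>Old a\<close> to
    \<open>Old b\<close>.\<close>
  obtain \<gamma> where \<gamma>: "\<gamma> \<in> lists I" "ev \<gamma> = inv\<^bsub>G\<^esub> g" 
  proof -
    have "inv\<^bsub>G\<^esub> g \<in> carrier G" using g by simp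
    from ev_surj[OF this] show ?thesis using that by metis
  qed
  let ?act = "\<lambda>c i. c #>\<^bsub>G\<^esub> ev [i]"
  interpret A: word_action I ev "rcosets\<^bsub>G\<^esub> H" ?act
    by (rule coset_word_action(1)[OF sub noconj])
  have HX: "H \<in> rcosets\<^bsub>G\<^esub> H" using rcosetsI[OF Hc one_closed] coset_mult_one[OF Hc] by simp
  note fold = coset_word_action(2)[OF sub noconj HX]
  have T: "w \<in> lists I \<and> foldl ?act H w = H" if "w \<in> T" for w
  proof -
    from that obtain s where s: "s \<in> S" "w = W s" unfolding T_def by blast
    then have "s \<in> H" unfolding H by (intro generate.incl)
    then show ?thesis using fold[of w] W[OF s(1)] s coset_join2[OF _ sub] Hc by auto
  qed
  have moves: "foldl ?act H \<gamma> \<noteq> H"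
  proof
    assume "foldl ?act H \<gamma> = H"
    then have "inv\<^bsub>G\<^esub> g \<in> H" using fold[of \<gamma>] \<gamma> g coset_join1[OF _ _ sub] by simp
    then have "inv\<^bsub>G\<^esub> (inv\<^bsub>G\<^esub> g) \<in> H" using subgroup.m_inv_closed[OF sub] by blast
    then show False using g by simp
  qed
  have finT: "finite T" "card T \<le> k"
    using S card_image_le[OF S(2), of W] unfolding T_def by auto
  obtain V0 E0 \<phi>0 a0 b0 where v0: "A.valid (card T) T \<gamma> H V0 E0 \<phi>0 a0 b0"
    using A.valid_exists[OF HX \<gamma>(1) finT(1) finite_atLeastAtMost T] by blast
  obtain V E \<phi> a b where val: "A.valid (card T) T \<gamma> H V E \<phi> a b"
    and min: "\<And>V' E' \<phi>' a' b'. A.valid (card T) T \<gamma> H V' E' \<phi>' a' b' \<Longrightarrow> card E \<le> card E'"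
    using A.valid_minimal_exists[OF v0] by metis
  interpret M: minimal_graph I ev "rcosets\<^bsub>G\<^esub> H" ?act "card T" T \<gamma> H V E \<phi> a b
    by unfold_locales (use val min moves in auto)
  \<comment> \<open>The value 0 stands for an infinite exponent, and also for equal or out-of-range
    indices, so that symmetry holds unconditionally.\<close>
  define ex where "ex i j = (if i \<in> I \<and> j \<in> I \<and> i \<noteq> j then case m i j of enat p \<Rightarrow> p | \<infinity> \<Rightarrow> 0 else 0)" for i j
  have m_sym: "m i j = m j i" if "i \<in> I" "j \<in> I" "i \<noteq> j" for i j
    using exps that unfolding coxeter_exponents_def by blast
  have ex_pos: "i \<in> I \<and> j \<in> I \<and> i \<noteq> j \<and> m i j = enat (ex i j)" if "0 < ex i j" for i j
    using that unfolding ex_def by (auto split: if_splits enat.splits)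
  have ex_eq: "ex i j = p" if "i \<in> I" "j \<in> I" "i \<noteq> j" "m i j = enat p" for i j p
    using that unfolding ex_def by simp
  have ex_large: "3 * k + 7 \<le> ex i j" if pos: "0 < ex i j" for i j
  proof -
    note * = ex_pos[OF pos]
    have "enat (3 * k + 7) \<le> m i j"
    proof (cases "i < j")
      case True
      then show ?thesis using large * by blast
    next
      case False
      then have "enat (3 * k + 7) \<le> m j i" using large * by auto
      then show ?thesis using m_sym[of i j] * by simp
    qed
    then show ?thesis using * by simp
  qed
  have ev_rel: "ev (concat (replicate (ex i j) [i, j])) = ev []" if pos: "0 < ex i j" for i j
    using ev_relator[of i j "ex i j"] ex_pos[OF pos] m_sym[of i j] by (simp add: ev_Nil)
  have ex_sym: "ex i j = ex j i" for i j
    using m_sym[of i j] unfolding ex_def by auto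
  interpret P: coxeter_completion n m V E ex
  proof unfold_locales
    show "finite I" "finite V" "E \<subseteq> V \<times> I \<times> V"
      using M.fin_V A.lgraphD(2)[OF M.L] by simp_all
    show "(w, i, u) \<in> E" if "(u, i, w) \<in> E" for u i w using M.edge_sym[OF that] .
    show "w = w'" if "(u, i, w) \<in> E" "(u, i, w') \<in> E" for u i w w' using M.folded[OF that] .
    show "(u, i, u) \<notin> E" for u i using M.no_loop by blast
    show "ex i j = ex j i" for i j by (rule ex_sym)
    show "even (ex i j)" if "i \<in> I" "j \<in> I" "i \<noteq> j" for i j
    proof (cases "ex i j = 0")
      case False
      then have "m i j = enat (ex i j)" using ex_pos by blast
      then show ?thesis using sep that unfolding separability_condition_def by blast
    qed simp
    show "2 \<le> ex i j" if "0 < ex i j" for i j using ex_large[OF that] by simp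
    show "3 dvd ex i j"
      if "i \<in> I" "j \<in> I" "l \<in> I" "i \<noteq> j" "i \<noteq> l" "j \<noteq> l" "0 < ex i j" "0 < ex i l" "0 < ex j l" for i j l
    proof -
      have 1: "m i j = enat (ex i j)" using ex_pos that(7) by blast
      have 2: "m i l = enat (ex i l)" using ex_pos that(8) by blast
      have 3: "m j l = enat (ex j l)" using ex_pos that(9) by blast
      have "m i l < \<infinity>" "m j l < \<infinity>" unfolding 2 3 by simp_all
      then show ?thesis using sep that(1-6) 1 unfolding separability_condition_def by blast
    qed
    show False
      if "i \<in> I" "j \<in> I" "i \<noteq> j" "0 < ex i j" "inj_on f {..2 * ex i j - 3}"
        "\<And>t. t < 2 * ex i j - 3 \<Longrightarrow> (f t, if even t then i else j, f (Suc t)) \<in> E" for i j f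
    proof (rule M.no_long_alternating_path[of i j "ex i j" f])
      show "3 * card T + 7 \<le> ex i j" using ex_large[OF that(4)] finT(2) by linarith
      show "ev (concat (replicate (ex i j) [i, j])) = ev []" by (rule ev_rel[OF that(4)])
    qed (use that in auto)
    show "walk E x (concat (replicate (ex i j) [i, j])) x"
      if ij: "i \<in> I" "j \<in> I" "i \<noteq> j" "0 < ex i j" and C: "C \<subseteq> V"
        and cl: "\<And>x y. x \<in> C \<Longrightarrow> y \<in> {i, j} \<Longrightarrow> \<exists>x'\<in>C. (x, y, x') \<in> E" and x: "x \<in> C"
      for i j C x
    proof -
      \<comment> \<open>Both labels can be followed inside \<open>C\<close>, so the relator can be
        read from \<open>x\<close>. Its end has the same image as \<open>x\<close>, and images are
        injective on \<open>C\<close>.\<close>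
      have "\<exists>x'\<in>C. walk E x (concat (replicate q [i, j])) x'" for q
        using x
      proof (induction q arbitrary: x)
        case (Suc q)
        obtain y where y: "y \<in> C" "(x, i, y) \<in> E" using cl[OF Suc.prems, of i] by blast
        obtain z where z: "z \<in> C" "(y, j, z) \<in> E" using cl[OF y(1), of j] by blast
        show ?case using Suc.IH[OF z(1)] y(2) z(2) by auto
      qed auto
      then obtain x' where x': "x' \<in> C" "walk E x (concat (replicate (ex i j) [i, j])) x'" by blast
      have "\<phi> x' = foldl ?act (\<phi> x) (concat (replicate (ex i j) [i, j]))"
        by (rule A.lgraph_walk_foldl[OF M.L x'(2)])
      also have "\<dots> = foldl ?act (\<phi> x) []"
        using C x by (intro A.act_ev M.X_vertex ev_rel[OF ij(4)]) blast
      finally have "\<phi> x' = \<phi> x" by simp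
      then have "x' = x" using inj_onD[OF M.inj_on_closed[OF C ij(3) cl]] x x'(1) by blast
      then show ?thesis using x'(2) by simp
    qed
    show "ex i j = p \<and> 0 < p" if ij: "i \<in> I" "j \<in> I" "i < j" "m i j = enat p" for i j p
    proof
      show "ex i j = p" using ex_eq ij by simp
      have "enat (3 * k + 7) \<le> enat p" using large ij by metis
      then show "0 < p" by simp
    qed
  qed
  have aP: "Old a \<in> P.points" using M.a_V unfolding P.points_def by blast
  have labels: "w \<in> lists I" if "walk E u w v" for u w v
    using that by (induction w arbitrary: u) (use M.edge_I in auto)
  \<comment> \<open>A loop at \<open>a\<close> need not read the chosen word \<open>W s\<close>,
    only some word of the same value; this is enough since \<open>act_hom\<close> depends on the
    value alone.\<close>
  have stab: "\<exists>w\<in>lists I. ev w = h \<and> foldr P.\<sigma> w (Old a) = Old a" if "h \<in> H" for h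
    using that unfolding H
  proof (induction h rule: generate.induct)
    case one
    then show ?case by (intro bexI[of _ "[]"]) (auto simp: ev_Nil)
  next
    case (incl s)
    then have "A.conn E a (W s) a" using A.validD(5)[OF val, of "W s"] unfolding T_def by blast
    then obtain w where w: "ev w = s" "walk E a w a" using W[OF incl] unfolding A.conn_def by auto
    have "foldr P.\<sigma> w (Old a) = Old a"
      using P.\<sigma>_walk[OF walk_rev[OF M.edge_sym w(2)]] by simp
    then show ?case using w labels by blast
  next
    case (inv s)
    then have "A.conn E a (W s) a" using A.validD(5)[OF val, of "W s"] unfolding T_def by blast
    then obtain w where w: "ev w = s" "walk E a w a" using W[OF inv] unfolding A.conn_def by auto
    have "foldr P.\<sigma> (rev w) (Old a) = Old a" by (rule P.\<sigma>_walk[OF w(2)])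
    moreover have "rev w \<in> lists I" using labels[OF w(2)] by auto
    ultimately show ?case using w(1) ev_rev by blast
  next
    case (eng h1 h2)
    then obtain w1 w2 where w: "w1 \<in> lists I" "ev w1 = h1" "foldr P.\<sigma> w1 (Old a) = Old a"
      "w2 \<in> lists I" "ev w2 = h2" "foldr P.\<sigma> w2 (Old a) = Old a" by blast
    then have "w1 @ w2 \<in> lists I" "ev (w1 @ w2) = h1 \<otimes>\<^bsub>G\<^esub> h2" "foldr P.\<sigma> (w1 @ w2) (Old a) = Old a"
      by (auto simp: ev_append)
    then show ?case by blast
  qed
  have fixH: "P.act_hom h (Old a) = Old a" if "h \<in> H" for h
    using stab[OF that] P.act_hom_ev[OF _ aP] by metis
  have "P.act_hom g (Old a) = Old b"
  proof -
    obtain w where w: "ev w = ev \<gamma>" "walk E a w b"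
      using A.validD(6)[OF val] unfolding A.conn_def by blast
    have "rev w \<in> lists I" using labels[OF w(2)] by auto
    then have "P.act_hom (ev (rev w)) (Old a) = Old b"
      using P.act_hom_ev[OF _ aP] P.\<sigma>_walk[OF w(2)] by simp
    moreover have "ev (rev w) = g" using w(1) \<gamma>(2) g by (simp add: ev_rev)
    ultimately show ?thesis by simp
  qed
  then have "P.act_hom g \<notin> P.act_hom ` H" using fixH M.a_neq_b by auto
  moreover have "finite (carrier (BijGroup P.points))"
  proof (rule finite_subset)
    show "carrier (BijGroup P.points) \<subseteq> P.points \<rightarrow>\<^sub>E P.points"
      unfolding BijGroup_def Bij_def PiE_def by (auto simp: bij_betw_def)
    show "finite (P.points \<rightarrow>\<^sub>E P.points)" by (intro finite_PiE P.finite_points)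
  qed
  ultimately show "\<exists>(K :: nat monoid) \<psi>. group K \<and> finite (carrier K) \<and> \<psi> \<in> epi G K \<and> \<psi> g \<notin> \<psi> ` H"
    using g by (intro finite_hom_witness[OF is_group group_BijGroup _ P.act_hom Hc]) auto
qed

end

theorem theoremB:
  fixes k n :: nat and m :: "nat \<Rightarrow> nat \<Rightarrow> enat" and G :: "nat word set monoid"
  assumes "k \<ge> 2"
    and "coxeter_exponents n m"
    and "G = coxeter_group n m"
    and "\<forall>i\<in>{1..n}. \<forall>j\<in>{1..n}. i < j \<longrightarrow> m i j \<ge> enat (3 * k + 7)"
    and "separability_condition n m"
  shows "(\<forall>H. k_generated_subgroup k G H \<and>
              (\<forall>i\<in>{1..n}. \<forall>g\<in>carrier G. g \<otimes>\<^bsub>G\<^esub> coxeter_gen n m i \<otimes>\<^bsub>G\<^esub> inv\<^bsub>G\<^esub> g \<notin> H)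
            \<longrightarrow> separable_in G H) \<and>
         (\<forall>H l. k_generated_subgroup l G H \<and> real l \<le> (real k + 1) / 2
            \<longrightarrow> separable_in G H)"
proof -
  interpret coxeter n m .
  note G = assms(3)
  note part1 = separable_without_conjugates[OF assms(2,4,5)]
  have "separable_in G H"
    if gen: "k_generated_subgroup k G H"
      and nc: "\<forall>i\<in>{1..n}. \<forall>g\<in>carrier G. g \<otimes>\<^bsub>G\<^esub> coxeter_gen n m i \<otimes>\<^bsub>G\<^esub> inv\<^bsub>G\<^esub> g \<notin> H" for H
  proof -
    obtain S where "S \<subseteq> carrier G" "finite S" "card S \<le> k" "H = generate G S"
      using gen unfolding k_generated_subgroup_def by blast
    then show ?thesis using part1 nc unfolding G by blast
  qed
  moreover have "separable_in G H"
    if gen: "k_generated_subgroup l G H" and l: "real l \<le> (real k + 1) / 2" for H l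
  proof -
    have "real (2 * l) \<le> real (k + 1)" using l by simp
    then have l': "2 * l \<le> k + 1" unfolding of_nat_le_iff .
    obtain S where S: "S \<subseteq> carrier G" "finite S" "card S \<le> l" and H: "H = generate G S"
      using gen unfolding k_generated_subgroup_def by blast
    have no_odd: "separable_in G N"
      if "S' \<subseteq> carrier G" "finite S'" "card S' \<le> k" "N = generate G S'" "\<And>h. h \<in> N \<Longrightarrow> \<not> odd_elt h" for S' N
      using part1[of S' N] that odd_elt_conj_gen unfolding G by blast
    show ?thesis
    proof (cases "\<exists>t\<in>S. odd_elt t")
      case True
      then obtain t where t: "t \<in> S" "odd_elt t" by blast
      obtain S' where S': "S' \<subseteq> carrier G" "finite S'" "card S' \<le> 2 * card S - 1"
        "generate G S' = {h \<in> generate G S. \<not> odd_elt h}"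
        using generate_even_part[of odd_elt S t] odd_elt_mult S(1,2) t unfolding G by blast
      \<comment> \<open>Here \<open>2 * card S - 1 \<le> 2 * l - 1 \<le> k\<close>, which is the
        origin of the bound \<open>(k + 1) / 2\<close>.\<close>
      have sepN: "separable_in G (generate G S')"
        using S' S(3) l' by (intro no_odd[of S']) auto
      have subH: "subgroup H G" unfolding H G by (rule generate_is_subgroup) (use S G in simp)
      have tH: "t \<in> H" unfolding H using t by (intro generate.incl)
      have cov: "h \<in> generate G S' \<or> h \<otimes>\<^bsub>G\<^esub> inv\<^bsub>G\<^esub> t \<in> generate G S'" if h: "h \<in> H" for h
      proof (cases "odd_elt h")
        case True
        have "h \<in> carrier (coxeter_group n m)" "t \<in> carrier (coxeter_group n m)"
          using h t(1) S(1) generate_in_carrier[of S] unfolding H G by blast+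
        then have "\<not> odd_elt (h \<otimes>\<^bsub>G\<^esub> inv\<^bsub>G\<^esub> t)"
          using True t(2) odd_elt_inv unfolding G by (simp add: odd_elt_mult)
        moreover have "h \<otimes>\<^bsub>G\<^esub> inv\<^bsub>G\<^esub> t \<in> H"
          using h t(1) unfolding H G by (intro generate.eng generate.inv)
        ultimately show ?thesis using S'(4) unfolding H G by blast
      next
        case False
        then show ?thesis using h S'(4) unfolding H G by blast
      qed
      have "generate G S' \<subseteq> H" using S'(4) unfolding H by blast
      then show ?thesis
        using separable_of_index_two[OF is_group subH[unfolded G] sepN[unfolded G] _ tH] cov
        unfolding G by blast
    next
      case False
      \<comment> \<open>Without an odd generator \<open>H\<close> itself consists of even elements,
        and \<open>card S \<le> l \<le> k\<close>.\<close>
      have "\<not> odd_elt h" if "h \<in> generate (coxeter_group n m) S" for h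
        using that
      proof (induction h rule: generate.induct)
        case one
        then show ?case by (rule odd_elt_one)
      next
        case (incl h)
        then show ?case using False by blast
      next
        case (inv h)
        then have "h \<in> carrier (coxeter_group n m)" using S(1) unfolding G by blast
        then show ?case using False inv odd_elt_inv by blast
      next
        case (eng h1 h2)
        then have "h1 \<in> carrier (coxeter_group n m)" "h2 \<in> carrier (coxeter_group n m)"
          using S(1) generate_in_carrier[of S] unfolding G by blast+
        then show ?case using eng.IH odd_elt_mult by simp
      qed
      moreover have "card S \<le> k" using S(3) l' assms(1) by linarith
      ultimately show ?thesis using no_odd[OF S(1,2), of H] unfolding H G by blast
    qed
  qed
  ultimately show ?thesis by blast
qed

end
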